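(* Let $p$ be a prime and let $k,n$ be natural numbers with $k+1\le p$ and $n+2\le p$. Fix an abelian group $(A,+)$ of cardinality $p^n$. Then the map sending a nilpotent pre-Lie ring $(A,+,\cdot)$ of nilpotency index $k$ to its group-of-flows brace $(A,+,\circ)$ is a bijection from the set of nilpotent pre-Lie ring structures on $(A,+)$ of nilpotency index $k$ onto the set of strongly nilpotent (left) brace structures on $(A,+)$ of nilpotency index $k$. Its inverse sends a strongly nilpotent brace $(A,+,\circ)$ to its associated pre-Lie ring $(A,+,\odot)$. In particular there is a one-to-one correspondence between strongly nilpotent braces of cardinality $p^n$ and nilpotency index $k$ and nilpotent pre-Lie rings of cardinality $p^n$ and nilpotency index $k$.
   Context: A (left) brace is a set $A$ with binary operations $+,\circ$ such that $(A,+)$ is an abelian group, $(A,\circ)$ is a group, and $a\circ(b+c)+a=a\circ b+a\circ c$ for all $a,b,c$. Write $a*b=a\circ b-a-b$. For additive subgroups $X,Y$, $X*Y$ is the additive subgroup generated by all $x*y$ ($x\in X,y\in Y$). Set $A^{1}=A^{(1)}=A^{[1]}=A$, $A^{i+1}=A*A^{i}$, $A^{(i+1)}=A^{(i)}*A$, $A^{[i+1]}=\sum_{j=1}^{i}A^{[j]}*A^{[i+1-j]}$. A brace is left nilpotent if $A^m=0$ for some $m$, right nilpotent if $A^{(m)}=0$ for some $m$, strongly nilpotent if $A^{[m]}=0$ for some $m$; it has nilpotency index $k$ if $A^{[k]}=0\ne A^{[k-1]}$. For an integer $m$, $ma$ is the $m$-fold additive multiple. A pre-Lie ring is an abelian group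 $(A,+)$ with a biadditive product $\cdot$ satisfying $(x\cdot y)\cdot z-x\cdot(y\cdot z)=(y\cdot x)\cdot z-y\cdot(x\cdot z)$. The series $A^i$, $A^{(i)}$, $A^{[i]}$ and the notions left nilpotent, right nilpotent, nilpotent (=strongly nilpotent: $A^{[m]}=0$ for some $m$, equivalently all products of $m$ elements with any bracketing vanish) and nilpotency index $k$ ($A^{[k]}=0\neq A^{[k-1]}$) are defined as for braces with $\cdot$ in place of $*$. Group of flows: let $(A,+,\cdot)$ be a left nilpotent pre-Lie ring of cardinality $p^n$ with $p>n+1$ prime. Let $A^{\mathrm{id}}=A\times\mathbb Z$ with $(r,m)+(s,m')=(r+s,m+m')$, $(r,m)\cdot(s,m')=(r\cdot s+ms+m'r,mm')$; identify $A$ with $A\times\{0\}$, put $1=(0,1)$. For $a\in A$ let $L_a(x)=a\cdot x$ and $e^{L_a}(x)=\sum_{j\ge 0}\frac{1}{j!}L_a^j(x)$ for $x\in A^{\mathrm{id}}$ (finite sum since $A^{n+1}=0$; the needed factorials are invertible modulo $p^n$). Let $W(a)=e^{L_a}(1)-1\in A$; $W:A\to A$ is a bijection, with inverse $\Omega$. The group of flows is $(A,\circ)$ with $a\circ b=a+e^{L_{\Omega(a)}}(b)$, and $(A,+,\circ)$ is the group-of-flows brace. Associated pre-Lie ring: let $\gamma$ be a primitive root modulo $p^p$ and $\xi=\gamma^{p^{p-1}}$. For a brace $(A,+,\circ)$ of cardinality $p^n$ define $a\cdot b=\sum_{i=0}^{p-2}\xi^{p-1-i}((\xi^i a)*b)$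 and $a\odot b=-(1+p+p^2+\dots+p^{n-1})(a\cdot b)$; $(A,+,\odot)$ is the pre-Lie ring associated to the brace. *)

theory Defs
  imports Main "HOL-Number_Theory.Number_Theory"
begin

fun natmul :: "nat \<Rightarrow> 'a::ab_group_add \<Rightarrow> 'a" where
  "natmul 0 a = 0"
| "natmul (Suc m) a = a + natmul m a"

definition zmul :: "int \<Rightarrow> 'a::ab_group_add \<Rightarrow> 'a" where
  "zmul m a = (if m \<ge> 0 then natmul (nat m) a else - natmul (nat (- m)) a)"

inductive_set addgen :: "'a::ab_group_add set \<Rightarrow> 'a set" for S where
  zero: "0 \<in> addgen S"
| base: "s \<in> S \<Longrightarrow> s \<in> addgen S"
| diff: "a \<in> addgen S \<Longrightarrow> b \<in> addgen S \<Longrightarrow> a - b \<in> addgen S"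

definition subprod :: "('a::ab_group_add \<Rightarrow> 'a \<Rightarrow> 'a) \<Rightarrow> 'a set \<Rightarrow> 'a set \<Rightarrow> 'a set" where
  "subprod op X Y = addgen {op x y | x y. x \<in> X \<and> y \<in> Y}"

definition subsum :: "nat set \<Rightarrow> (nat \<Rightarrow> 'a::ab_group_add set) \<Rightarrow> 'a set" where
  "subsum J F = addgen (\<Union>j\<in>J. F j)"

lemma subsum_cong [fundef_cong]:
  "J = J' \<Longrightarrow> (\<And>j. j \<in> J' \<Longrightarrow> F j = G j) \<Longrightarrow> subsum J F = subsum J' G"
  unfolding subsum_def by simp

text \<open>Strong series: strong_series op i = A^[i] for i \<ge> 1; A^[1] = A,
  A^[i+1] = sum_{j=1..i} A^[j] * A^[i+1-j]. (Index 0 is set to A as well.)\<close>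
function strong_series :: "('a::ab_group_add \<Rightarrow> 'a \<Rightarrow> 'a) \<Rightarrow> nat \<Rightarrow> 'a set" where
  "strong_series op i =
     (if i \<le> 1 then UNIV
      else subsum {1..i - 1} (\<lambda>j. subprod op (strong_series op j) (strong_series op (i - j))))"
  by auto
termination
proof (relation "measure snd")
  show "wf (measure snd)" by simp
qed (auto simp: subsum_def intro!: image_cong)

definition nilpotency_index :: "('a::ab_group_add \<Rightarrow> 'a \<Rightarrow> 'a) \<Rightarrow> nat \<Rightarrow> bool" where
  "nilpotency_index op k \<longleftrightarrow> strong_series op k = {0} \<and> strong_series op (k - 1) \<noteq> {0}"

definition is_prelie :: "('a::ab_group_add \<Rightarrow> 'a \<Rightarrow> 'a) \<Rightarrow> bool" where
  "is_prelie m \<longleftrightarrow>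
     (\<forall>x y z. m (x + y) z = m x z + m y z) \<and>
     (\<forall>x y z. m x (y + z) = m x y + m x z) \<and>
     (\<forall>x y z. m (m x y) z - m x (m y z) = m (m y x) z - m y (m x z))"

definition is_group_op :: "('a \<Rightarrow> 'a \<Rightarrow> 'a) \<Rightarrow> bool" where
  "is_group_op c \<longleftrightarrow>
     (\<forall>a b d. c (c a b) d = c a (c b d)) \<and>
     (\<exists>e. (\<forall>a. c e a = a \<and> c a e = a) \<and> (\<forall>a. \<exists>b. c a b = e \<and> c b a = e))"

definition is_brace :: "('a::ab_group_add \<Rightarrow> 'a \<Rightarrow> 'a) \<Rightarrow> bool" where
  "is_brace c \<longleftrightarrow> is_group_op c \<and> (\<forall>a b d. c a (b + d) + a = c a b + c a d)"

definition brace_star :: "('a::ab_group_add \<Rightarrow> 'a \<Rightarrow> 'a) \<Rightarrow> 'a \<Rightarrow> 'a \<Rightarrow> 'a" where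
  "brace_star c a b = c a b - a - b"

definition prelie_structures :: "nat \<Rightarrow> ('a::ab_group_add \<Rightarrow> 'a \<Rightarrow> 'a) set" where
  "prelie_structures k = {m. is_prelie m \<and> nilpotency_index m k}"

definition brace_structures :: "nat \<Rightarrow> ('a::ab_group_add \<Rightarrow> 'a \<Rightarrow> 'a) set" where
  "brace_structures k = {c. is_brace c \<and> nilpotency_index (brace_star c) k}"

definition id_add :: "('a::ab_group_add \<times> int) \<Rightarrow> ('a \<times> int) \<Rightarrow> ('a \<times> int)" where
  "id_add x y = (fst x + fst y, snd x + snd y)"

definition id_mult :: "('a::ab_group_add \<Rightarrow> 'a \<Rightarrow> 'a) \<Rightarrow> ('a \<times> int) \<Rightarrow> ('a \<times> int) \<Rightarrow> ('a \<times> int)" where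
  "id_mult m x y = (m (fst x) (fst y) + zmul (snd x) (fst y) + zmul (snd y) (fst x), snd x * snd y)"

definition inv_fact :: "nat \<Rightarrow> nat \<Rightarrow> nat \<Rightarrow> int" where
  "inv_fact p n j = (SOME u. [int (fact j) * u = 1] (mod int (p ^ n)))"

text \<open>e^{L_a}(x) = sum_{j=0..n} (1/j!) L_a^j(x) on A^id (the terms j > n vanish
  since A^{n+1} = 0; for j \<ge> 1 the term lies in A, the j = 0 term is x).\<close>
definition expL :: "nat \<Rightarrow> nat \<Rightarrow> ('a::ab_group_add \<Rightarrow> 'a \<Rightarrow> 'a) \<Rightarrow> 'a \<Rightarrow> ('a \<times> int) \<Rightarrow> ('a \<times> int)" where
  "expL p n m a x =
     (let t = (\<lambda>j. ((id_mult m (a, 0)) ^^ j) x) in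
      id_add x ((\<Sum>j\<in>{1..n}. zmul (inv_fact p n j) (fst (t j))),
                (\<Sum>j\<in>{1..n}. inv_fact p n j * snd (t j))))"

definition flowW :: "nat \<Rightarrow> nat \<Rightarrow> ('a::ab_group_add \<Rightarrow> 'a \<Rightarrow> 'a) \<Rightarrow> 'a \<Rightarrow> 'a" where
  "flowW p n m a = fst (id_add (expL p n m a (0, 1)) (0, - 1))"

definition flowOmega :: "nat \<Rightarrow> nat \<Rightarrow> ('a::ab_group_add \<Rightarrow> 'a \<Rightarrow> 'a) \<Rightarrow> 'a \<Rightarrow> 'a" where
  "flowOmega p n m = inv_into UNIV (flowW p n m)"

definition group_of_flows :: "nat \<Rightarrow> nat \<Rightarrow> ('a::ab_group_add \<Rightarrow> 'a \<Rightarrow> 'a) \<Rightarrow> ('a \<Rightarrow> 'a \<Rightarrow> 'a)" where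
  "group_of_flows p n m = (\<lambda>a b. a + fst (expL p n m (flowOmega p n m a) (b, 0)))"

definition assoc_dot :: "nat \<Rightarrow> nat \<Rightarrow> ('a::ab_group_add \<Rightarrow> 'a \<Rightarrow> 'a) \<Rightarrow> 'a \<Rightarrow> 'a \<Rightarrow> 'a" where
  "assoc_dot p \<gamma> c a b =
     (let \<xi> = \<gamma> ^ (p ^ (p - 1)) in
      \<Sum>i\<in>{0..p - 2}. zmul (int (\<xi> ^ (p - 1 - i))) (brace_star c (zmul (int (\<xi> ^ i)) a) b))"

definition assoc_prelie :: "nat \<Rightarrow> nat \<Rightarrow> nat \<Rightarrow> ('a::ab_group_add \<Rightarrow> 'a \<Rightarrow> 'a) \<Rightarrow> ('a \<Rightarrow> 'a \<Rightarrow> 'a)" where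
  "assoc_prelie p n \<gamma> c =
     (\<lambda>a b. zmul (- int (\<Sum>i<n. p ^ i)) (assoc_dot p \<gamma> c a b))"

end

theory Submission
  imports Defs "HOL-Computational_Algebra.Formal_Power_Series" "HOL-Algebra.Coset"
begin

text \<open>
  Since \<open>A\<^sup>[\<^sup>k\<^sup>] = 0\<close> with \<open>k < p\<close>, every map that occurs is polynomial of degree less than \<open>p - 1\<close>, and
  the averaging over powers of \<open>\<xi>\<close> in the definition of the associated pre-Lie ring extracts
  linear coefficients.

  From braces to pre-Lie rings: iterated differences show that \<open>a \<mapsto> a * b\<close> is polynomial with respect
  to the strong series, and \<open>a \<odot> b\<close> is its linear part.  Along a polynomial path through \<open>0\<close> the linear
  coefficient of \<open>f(t) * b\<close> is \<open>f'(0) \<odot> b\<close>.  The path \<open>(t a) \<circ> (t c)\<close> gives additivity of \<open>\<odot>\<close>;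
  the associator of \<open>\<odot>\<close> is a mixed second derivative, hence symmetric; and the one-parameter
  path of circle powers of \<open>a\<close> satisfies the equation of a flow, so \<open>\<circ>\<close> is the group of flows of \<open>\<odot>\<close>.

  From pre-Lie rings to braces: associativity of the group of flows says
  \<open>e\<^bsup>L x\<^esup> e\<^bsup>L y\<^esup> = e\<^bsup>L z\<^esup>\<close> whenever \<open>W z = W x + e\<^bsup>L x\<^esup> (W y)\<close>.  Replacing \<open>x\<close> by \<open>t x\<close>, both sides solve the
  same linear differential equation in \<open>t\<close>, by the formula for the derivative of the exponential.

  The two constructions respect the strong series in both directions, which gives equality of
  the nilpotency indices.
\<close>

section \<open>Filtered algebras of prime power exponent\<close>

lemma zmul_add_one: "zmul (i + 1) x = zmul i x + x"
proof (cases "i \<ge> 0")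
  case True
  then have "nat (i + 1) = Suc (nat i)" by simp
  then show ?thesis using True by (simp add: zmul_def)
next
  case False
  then have "nat (- i) = Suc (nat (- (i + 1)))" by simp
  then show ?thesis using False by (auto simp: zmul_def)
qed

lemma zmul_zero_left: "zmul 0 x = 0"
  by (simp add: zmul_def)

lemma zmul_add_left: "zmul (i + j) x = zmul i x + zmul j x"
proof (induction i rule: int_induct[where k = 0])
  case base
  then show ?case by (simp add: zmul_zero_left)
next
  case (step1 i)
  then show ?case using zmul_add_one[of "i + j" x] zmul_add_one[of i x] by (simp add: algebra_simps)
next
  case (step2 i)
  then show ?case using zmul_add_one[of "i - 1 + j" x] zmul_add_one[of "i - 1" x] by (simp add: algebra_simps)
qed

lemma zmul_add_right: "zmul i (x + y) = zmul i x + zmul i y"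
proof (induction i rule: int_induct[where k = 0])
  case base
  then show ?case by (simp add: zmul_zero_left)
next
  case (step1 i)
  then show ?case by (simp add: zmul_add_one)
next
  case (step2 i)
  then show ?case using zmul_add_one[of "i - 1" x] zmul_add_one[of "i - 1" y] zmul_add_one[of "i - 1" "x + y"]
    by (simp add: algebra_simps)
qed

lemma zmul_mult: "zmul i (zmul j x) = zmul (i * j) x"
proof (induction i rule: int_induct[where k = 0])
  case base
  then show ?case by (simp add: zmul_zero_left)
next
  case (step1 i)
  then show ?case using zmul_add_one[of i "zmul j x"] zmul_add_left[of "i * j" j x]
    by (simp add: algebra_simps)
next
  case (step2 i)
  then show ?case using zmul_add_one[of "i - 1" "zmul j x"] zmul_add_left[of "(i - 1) * j" j x]
    by (simp add: algebra_simps)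
qed

interpretation zm: Modules.module "zmul :: int \<Rightarrow> 'a::ab_group_add \<Rightarrow> 'a"
proof
  fix x :: 'a
  show "zmul 1 x = x" using zmul_add_one[of 0 x] by (simp add: zmul_zero_left)
qed (rule zmul_add_right zmul_add_left zmul_mult)+

lemma additive_sum:
  assumes "\<And>x y. f (x + y) = f x + f y"
  shows "f (sum g S) = (\<Sum>i\<in>S. f (g i :: 'a::ab_group_add)) \<and> f 0 = (0 :: 'b::ab_group_add)"
proof -
  have f0: "f 0 = 0" using assms[of 0 0] by simp
  then show ?thesis using assms by (induction S rule: infinite_finite_induct) auto
qed

lemma additive_zmul:
  assumes add: "\<And>x y. f (x + y) = f x + (f y :: 'b::ab_group_add)"
  shows "f (zmul i x) = zmul i (f x)"
proof (induction i rule: int_induct[where k = 0])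
  case base
  then show ?case using add[of 0 0] by simp
next
  case (step1 i)
  then show ?case by (simp add: zmul_add_one add)
next
  case (step2 i)
  then show ?case using zmul_add_one[of "i - 1" x] zmul_add_one[of "i - 1" "f x"] add[of "zmul (i - 1) x" x]
    by (simp add: algebra_simps)
qed

lemma sum_square_eq_triangle:
  fixes T :: "nat \<Rightarrow> nat \<Rightarrow> 'a::comm_monoid_add"
  assumes "\<And>i l. i + l \<ge> M \<Longrightarrow> T i l = 0"
  shows "(\<Sum>i<M. \<Sum>l<M. T i l) = (\<Sum>j<M. \<Sum>i\<le>j. T i (j - i))"
proof -
  have "(\<Sum>i<M. \<Sum>l<M. T i l) = (\<Sum>(i, l)\<in>{..<M} \<times> {..<M}. T i l)"
    by (rule sum.cartesian_product)
  also have "\<dots> = (\<Sum>(i, l)\<in>{(i, l). i + l < M}. T i l)"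
    using assms by (intro sum.mono_neutral_right) (auto simp: not_less[symmetric])
  also have "\<dots> = (\<Sum>j<M. \<Sum>i\<le>j. T i (j - i))"
    by (rule sum.triangle_reindex)
  finally show ?thesis .
qed

text \<open>\<open>inv_fact\<close> is a choice, so this congruence is all that is known of it. It
  rests on p not dividing j! for j < p.\<close>

lemma inv_fact:
  assumes "prime p" "j < p"
  shows "[int (fact j) * inv_fact p n j = 1] (mod int (p ^ n))"
proof -
  have "coprime (fact j) (p ^ n)"
    using assms by (metis coprime_commute coprime_power_left_iff linorder_not_less prime_dvd_fact_iff prime_imp_coprime)
  then have "coprime (int (fact j)) (int (p ^ n))"
    using coprime_int_iff by blast
  then have "\<exists>u. [int (fact j) * u = 1] (mod int (p ^ n))"
    by (rule cong_solve_coprime_int)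
  then show ?thesis unfolding inv_fact_def by (rule someI_ex)
qed

text \<open>\<open>F\<close> abstracts the strong series. \<open>F 0\<close> need not be the whole
  group: the power series whose j-th coefficient lies in \<open>F j\<close> form a second instance.
  Since \<open>F k\<close> vanishes and k < p, the factorials in surviving terms are
  invertible.\<close>

locale torsion_filtration =
  fixes p n k :: nat and F :: "nat \<Rightarrow> 'a::ab_group_add set"
  assumes prime_p: "prime p" and k_less: "k < p" and k_ge: "2 \<le> k"
    and torsion: "zmul (int (p ^ n)) (x::'a) = 0"
    and F_zero: "0 \<in> F i"
    and F_diff: "a \<in> F i \<Longrightarrow> b \<in> F i \<Longrightarrow> a - b \<in> F i"
    and F_Suc: "F (Suc i) \<subseteq> F i"
    and F_k: "a \<in> F k \<Longrightarrow> a = 0"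
    and F_0_1: "F 0 \<subseteq> F 1"
begin

abbreviation u :: "nat \<Rightarrow> int" where "u \<equiv> inv_fact p n"

lemma zmul_cong:
  assumes "[r = s] (mod int (p ^ n))"
  shows "zmul r (x::'a) = zmul s x"
proof -
  obtain d where "r = s + int (p ^ n) * d"
    using assms by (metis cong_iff_lin cong_sym)
  then show ?thesis
    by (metis add.right_neutral torsion zmul_add_left zmul_mult)
qed

lemma u_fact: "j < p \<Longrightarrow> zmul (int (fact j) * u j) (x::'a) = x"
  using zmul_cong[OF inv_fact[OF prime_p]] by simp

lemma fact_cancel:
  assumes "j < p" "zmul (int (fact j)) (x::'a) = zmul (int (fact j)) y"
  shows "x = y"
  by (metis assms u_fact zmul_mult mult.commute)

lemma nat_cancel:
  assumes "0 < j" "j < p" "zmul (int j) (x::'a) = zmul (int j) y"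
  shows "x = y"
proof (rule fact_cancel[OF \<open>j < p\<close>])
  have "int (fact j) = int (fact (j - 1)) * int j"
    using \<open>0 < j\<close> by (metis fact_reduce mult.commute of_nat_fact of_nat_mult)
  then show "zmul (int (fact j)) x = zmul (int (fact j)) y"
    using assms(3) by (metis zmul_mult)
qed

lemma u_0 [simp]: "zmul (u 0) (x::'a) = x"
  using u_fact[of 0] prime_gt_0_nat[OF prime_p] by simp

lemma u_1 [simp]: "zmul (u (Suc 0)) (x::'a) = x"
  using u_fact[of 1] prime_gt_1_nat[OF prime_p] by simp

lemma u_Suc:
  assumes "Suc j < p"
  shows "zmul (int (Suc j)) (zmul (u (Suc j)) (x::'a)) = zmul (u j) x"
proof (rule fact_cancel)
  show "j < p" using assms by simp
  have "int (fact j) * (int (Suc j) * u (Suc j)) = int (fact (Suc j)) * u (Suc j)"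
    by (simp add: algebra_simps)
  then show "zmul (int (fact j)) (zmul (int (Suc j)) (zmul (u (Suc j)) x)) =
      zmul (int (fact j)) (zmul (u j) x)"
    by (metis Suc_lessD assms u_fact zmul_mult)
qed

text \<open>The \<open>u j\<close> are inverses only modulo p^n, so C(j,i)/j! = 1/(i! (j-i)!) is
  stated through its action on the group and checked after multiplication by j!.\<close>

lemma u_binomial:
  assumes "j < p" "i \<le> j"
  shows "zmul (u j * int (j choose i)) (x::'a) = zmul (u i) (zmul (u (j - i)) x)"
proof (rule fact_cancel[OF \<open>j < p\<close>])
  have f: "int (fact j) = int (fact i) * int (fact (j - i)) * int (j choose i)"
    using binomial_fact_lemma[OF \<open>i \<le> j\<close>] by (metis of_nat_mult)
  have "zmul (int (fact j)) (zmul (u j * int (j choose i)) x) =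
      zmul (int (fact j) * u j) (zmul (int (j choose i)) x)"
    by (simp add: zmul_mult algebra_simps)
  also have "\<dots> = zmul (int (j choose i)) x"
    using assms by (simp only: u_fact)
  also have "\<dots> = zmul (int (fact i) * u i) (zmul (int (fact (j - i)) * u (j - i)) (zmul (int (j choose i)) x))"
    using assms by (simp only: u_fact less_imp_diff_less le_less_trans)
  also have "\<dots> = zmul (int (fact j)) (zmul (u i) (zmul (u (j - i)) x))"
    unfolding f by (simp add: zmul_mult algebra_simps)
  finally show "zmul (int (fact j)) (zmul (u j * int (j choose i)) x) =
      zmul (int (fact j)) (zmul (u i) (zmul (u (j - i)) x))" .
qed

lemma F_uminus: "a \<in> F i \<Longrightarrow> - a \<in> F i"
  using F_diff[OF F_zero] by (metis diff_0)

lemma F_add: "a \<in> F i \<Longrightarrow> b \<in> F i \<Longrightarrow> a + b \<in> F i"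
  using F_diff[OF _ F_uminus] by (metis diff_minus_eq_add)

lemma F_sum: "(\<And>x. x \<in> S \<Longrightarrow> f x \<in> F i) \<Longrightarrow> sum f S \<in> F i"
  by (induction S rule: infinite_finite_induct) (auto intro: F_zero F_add)

lemma F_zmul:
  assumes "a \<in> F i"
  shows "zmul r a \<in> F i"
proof (induction r rule: int_induct[where k = 0])
  case base
  then show ?case by (simp add: F_zero)
next
  case (step1 r)
  then show ?case by (simp add: zmul_add_one F_add assms)
next
  case (step2 r)
  then show ?case using F_diff[OF _ assms] by (simp add: zm.scale_left_diff_distrib)
qed

lemma F_antimono: "i \<le> j \<Longrightarrow> F j \<subseteq> F i"
  by (rule lift_Suc_antimono_le[of F]) (rule F_Suc)

lemma F_mono: "a \<in> F j \<Longrightarrow> i \<le> j \<Longrightarrow> a \<in> F i"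
  using F_antimono by blast

lemma F_large: "a \<in> F i \<Longrightarrow> k \<le> i \<Longrightarrow> a = 0"
  using F_antimono F_k by blast

lemma F_01: "a \<in> F 0 \<Longrightarrow> a \<in> F (Suc 0)"
  using F_0_1 by auto

text \<open>A contraction argument in nilpotent form: climbing one level at a time reaches
  \<open>F k\<close>, which is zero. Several uniqueness proofs below rest on it.\<close>

lemma F_converge:
  assumes "a \<in> F 0" "\<And>i. a \<in> F i \<Longrightarrow> a \<in> F (Suc i)"
  shows "a = 0"
proof -
  have "a \<in> F i" for i by (induction i) (auto intro: assms)
  then show ?thesis using F_k by blast
qed

end

section \<open>Truncated exponentials in a filtered algebra\<close>

locale filtered_algebra = torsion_filtration p n k F
  for p n k and F :: "nat \<Rightarrow> 'a::ab_group_add set" +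
  fixes m :: "'a \<Rightarrow> 'a \<Rightarrow> 'a"
  assumes add_left: "m (x + y) z = m x z + m y z"
    and add_right: "m x (y + z) = m x y + m x z"
    and F_mult: "x \<in> F i \<Longrightarrow> y \<in> F j \<Longrightarrow> m x y \<in> F (i + j)"
begin

lemma zero_left [simp]: "m 0 z = 0" using add_left[of 0 0 z] by simp
lemma zero_right [simp]: "m z 0 = 0" using add_right[of z 0 0] by simp
lemma diff_left: "m (x - y) z = m x z - m y z" using add_left[of "x - y" y z] by simp
lemma diff_right: "m x (y - z) = m x y - m x z" using add_right[of x "y - z" z] by simp
lemma sum_left: "m (sum g S) z = (\<Sum>i\<in>S. m (g i) z)"
  using additive_sum[of "\<lambda>x. m x z"] add_left by blast
lemma sum_right: "m z (sum g S) = (\<Sum>i\<in>S. m z (g i))"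
  using additive_sum[of "m z"] add_right by blast
lemma zmul_left: "m (zmul r x) z = zmul r (m x z)"
  using additive_zmul[of "\<lambda>x. m x z"] add_left by blast
lemma zmul_right: "m z (zmul r x) = zmul r (m z x)"
  using additive_zmul[of "m z"] add_right by blast

text \<open>The sum stops at k, where the filtration kills the terms, whereas \<open>expL\<close>
  stops at n; \<open>expL_eq_E\<close> matches the two.\<close>

definition E :: "'a \<Rightarrow> 'a \<Rightarrow> 'a" where
  "E a x = (\<Sum>j<k. zmul (u j) ((m a ^^ j) x))"

text \<open>This is e^(L_a)(1) - 1 with the adjoined unit eliminated: L_a^(j+1)(1) = L_a^j(a), which
  accounts for the shifted index of \<open>u\<close>.\<close>

definition W :: "'a \<Rightarrow> 'a" where
  "W a = (\<Sum>j<k. zmul (u (Suc j)) ((m a ^^ j) a))"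

lemma pow_add: "(m a ^^ j) (x + y) = (m a ^^ j) x + (m a ^^ j) y"
  by (induction j) (auto simp: add_right)

lemma pow_zmul_left: "(m (zmul r a) ^^ j) x = zmul (r ^ j) ((m a ^^ j) x)"
  by (induction j) (auto simp: zmul_right zmul_left mult.commute)

lemma pow_zmul_right: "(m a ^^ j) (zmul r x) = zmul r ((m a ^^ j) x)"
  by (induction j) (auto simp: zmul_right)

lemma pow_F:
  assumes "a \<in> F i" "x \<in> F r"
  shows "(m a ^^ j) x \<in> F (i * j + r)"
proof (induction j)
  case 0
  then show ?case using assms by simp
next
  case (Suc j)
  then show ?case using F_mult[OF assms(1) Suc] by (simp add: algebra_simps)
qed

lemma pow_F0: "a \<in> F 0 \<Longrightarrow> x \<in> F r \<Longrightarrow> (m a ^^ j) x \<in> F (j + r)"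
  using pow_F[OF F_01] by simp

lemma pow_vanish: "a \<in> F 0 \<Longrightarrow> x \<in> F 0 \<Longrightarrow> k \<le> Suc j \<Longrightarrow> (m a ^^ j) x = 0"
  using F_large[OF pow_F0[OF _ F_01]] by simp

lemma E_add: "E a (x + y) = E a x + E a y"
  by (simp add: E_def pow_add zm.scale_right_distrib sum.distrib)

lemma E_diff: "E a (x - y) = E a x - E a y"
  using E_add[of a "x - y" y] by simp

lemma E_zero_right [simp]: "E a 0 = 0"
  using E_add[of a 0 0] by simp

lemma k_split: "{..<k} = insert 0 {1..<k}"
  using k_ge by auto

lemma pow_zero_left: "j > 0 \<Longrightarrow> (m 0 ^^ j) x = 0"
  by (cases j) auto

lemma E_zero_left [simp]: "E 0 x = x"
  unfolding E_def k_split by (simp add: pow_zero_left)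

lemma W_zero [simp]: "W 0 = 0"
  unfolding W_def k_split by (simp add: pow_zero_left)

lemma E_sub:
  assumes "a \<in> F i" "x \<in> F r"
  shows "E a x - x \<in> F (i + r)"
proof -
  have "E a x - x = (\<Sum>j\<in>{1..<k}. zmul (u j) ((m a ^^ j) x))"
    unfolding E_def k_split by simp
  also have "\<dots> \<in> F (i + r)"
    by (intro F_sum F_zmul F_mono[OF pow_F[OF assms]]) auto
  finally show ?thesis .
qed

lemma E_F:
  assumes "a \<in> F 0" "x \<in> F r"
  shows "E a x \<in> F r"
  using F_add[OF F_mono[OF E_sub[OF assms]] assms(2)] by simp

lemma E_inj:
  assumes "a \<in> F 0" "x \<in> F 0" "E a x = 0"
  shows "x = 0"
proof (rule F_converge[OF assms(2)])
  fix i assume "x \<in> F i"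
  from E_sub[OF F_01[OF assms(1)] this] have "- x \<in> F (Suc i)" using assms by simp
  then show "x \<in> F (Suc i)" using F_uminus by fastforce
qed

lemma pow_diff_F:
  assumes "a \<in> F 0" "b \<in> F 0" "a - b \<in> F i"
  shows "(m a ^^ j) a - (m b ^^ j) b \<in> F (j + i)"
proof (induction j)
  case 0
  then show ?case using assms by simp
next
  case (Suc j)
  have "(m a ^^ Suc j) a - (m b ^^ Suc j) b =
      m a ((m a ^^ j) a - (m b ^^ j) b) + m (a - b) ((m b ^^ j) b)"
    by (simp add: diff_left diff_right)
  also have "\<dots> \<in> F (Suc j + i)"
    using F_mult[OF F_01[OF assms(1)] Suc] F_mult[OF assms(3) pow_F0[OF assms(2) F_01[OF assms(2)]], of j]
    by (intro F_add) (auto simp: algebra_simps)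
  finally show ?case .
qed

text \<open>By \<open>pow_diff_F\<close> the terms with j \<ge> 1 lie at least one level deeper than
  a - b, so \<open>W\<close> is the identity up to a contraction. Injectivity, surjectivity and
  \<open>W_F_iff\<close> follow from this.\<close>

lemma W_approx:
  assumes "a \<in> F 0" "b \<in> F 0" "a - b \<in> F i"
  shows "W a - W b - (a - b) \<in> F (Suc i)"
proof -
  have "W a - W b - (a - b) = (\<Sum>j\<in>{1..<k}. zmul (u (Suc j)) ((m a ^^ j) a - (m b ^^ j) b))"
    unfolding W_def k_split by (simp add: zm.scale_right_diff_distrib sum_subtractf)
  also have "\<dots> \<in> F (Suc i)"
    by (intro F_sum F_zmul F_mono[OF pow_diff_F[OF assms]]) auto
  finally show ?thesis .
qed

lemma W_F0: "a \<in> F 0 \<Longrightarrow> W a \<in> F 0"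
  unfolding W_def by (intro F_sum F_zmul F_mono[OF pow_F0]) auto

lemma W_inj:
  assumes "a \<in> F 0" "b \<in> F 0" "W a = W b"
  shows "a = b"
proof -
  have "a - b = 0"
  proof (rule F_converge[OF F_diff[OF assms(1,2)]])
    fix i assume "a - b \<in> F i"
    from W_approx[OF assms(1,2) this] have "- (a - b) \<in> F (Suc i)" using assms by simp
    then show "a - b \<in> F (Suc i)" using F_uminus by fastforce
  qed
  then show ?thesis by simp
qed

lemma W_surj:
  assumes "w \<in> F 0"
  obtains z where "z \<in> F 0" "W z = w"
proof -
  have "\<exists>z\<in>F 0. w - W z \<in> F i" for i
  proof (induction i)
    case 0
    then show ?case using assms F_zero by (intro bexI[of _ 0]) auto
  next
    case (Suc i)
    then obtain z where z: "z \<in> F 0" "w - W z \<in> F i" by blast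
    \<comment> \<open>Successive approximation: adding the defect to z changes W z by that defect,
      up to an error one level deeper.\<close>
    let ?z = "z + (w - W z)"
    have z': "?z \<in> F 0" using z F_add F_mono by blast
    have "W ?z - W z - (?z - z) \<in> F (Suc i)"
      using W_approx[OF z' z(1)] z(2) by simp
    then have "- (W ?z - W z - (?z - z)) \<in> F (Suc i)" by (rule F_uminus)
    then show ?case using z' by (intro bexI[of _ ?z]) auto
  qed
  then show ?thesis using that F_k by (metis right_minus_eq)
qed

lemma W_F_iff:
  assumes "a \<in> F 0"
  shows "W a \<in> F i \<longleftrightarrow> a \<in> F i"
proof
  assume "a \<in> F i"
  then have "W a - a \<in> F i" using F_mono[OF W_approx[OF assms F_zero, of i]] by simp
  from F_add[OF this \<open>a \<in> F i\<close>] show "W a \<in> F i" by simp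
next
  assume w: "W a \<in> F i"
  show "a \<in> F i"
    using w
  proof (induction i)
    case 0
    then show ?case using assms by simp
  next
    case (Suc i)
    then have "a \<in> F i" using F_Suc by blast
    then have "W a - a \<in> F (Suc i)" using W_approx[OF assms F_zero] by simp
    then have "W a - (W a - a) \<in> F (Suc i)" using Suc.prems F_diff by blast
    then show ?case by simp
  qed
qed

end

section \<open>Composition of flows in a filtered pre-Lie ring\<close>

text \<open>Pascal's rule, packaged as the common induction step of \<open>D_pow\<close> and
  \<open>D_pow_self\<close>, where applying L_Z to the i-th summand yields B (i + 1) + B i.\<close>

lemma binomial_sum_step:
  fixes B :: "nat \<Rightarrow> 'a::ab_group_add"
  shows "B 0 + (\<Sum>i<j. zmul (int (j choose Suc i)) (B (Suc i) + B i)) =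
    (\<Sum>i<Suc j. zmul (int (Suc j choose Suc i)) (B i))"
proof -
  have "(\<Sum>i<Suc j. zmul (int (Suc j choose Suc i)) (B i)) =
      (\<Sum>i<Suc j. zmul (int (j choose i)) (B i)) + (\<Sum>i<Suc j. zmul (int (j choose Suc i)) (B i))"
    by (simp add: zmul_add_left sum.distrib del: sum.lessThan_Suc)
  also have "(\<Sum>i<Suc j. zmul (int (j choose i)) (B i)) = B 0 + (\<Sum>i<j. zmul (int (j choose Suc i)) (B (Suc i)))"
    by (subst sum.lessThan_Suc_shift) simp
  also have "(\<Sum>i<Suc j. zmul (int (j choose Suc i)) (B i)) = (\<Sum>i<j. zmul (int (j choose Suc i)) (B i))"
    by (simp add: binomial_eq_0)
  finally show ?thesis
    by (simp add: zm.scale_right_distrib sum.distrib)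
qed

lemma hom_pow:
  assumes "\<And>c d. c \<in> S \<Longrightarrow> d \<in> S \<Longrightarrow> h (m' c d) = m (h c) (h d)"
    and "\<And>c d. c \<in> S \<Longrightarrow> d \<in> S \<Longrightarrow> m' c d \<in> S" and "a \<in> S" "x \<in> S"
  shows "h ((m' a ^^ j) x) = (m (h a) ^^ j) (h x)"
proof -
  have "(m' a ^^ j) x \<in> S" for j by (induction j) (use assms in auto)
  then show ?thesis by (induction j) (use assms in auto)
qed

locale filtered_prelie = filtered_algebra p n k F m
  for p n k and F :: "nat \<Rightarrow> 'a::ab_group_add set" and m +
  assumes prelie: "m (m x y) z - m x (m y z) = m (m y x) z - m y (m x z)"

text \<open>In the application \<open>D\<close> is the Euler operator t d/dt on power series, so
  differential equations in t become algebra with a derivation.\<close>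

locale filtered_prelie_derivation = filtered_prelie p n k F m
  for p n k and F :: "nat \<Rightarrow> 'a::ab_group_add set" and m +
  fixes D :: "'a \<Rightarrow> 'a"
  assumes D_add: "D (x + y) = D x + D y"
    and D_mult: "D (m x y) = m (D x) y + m x (D y)"
    and D_F: "x \<in> F i \<Longrightarrow> D x \<in> F i"
begin

lemma D_zero [simp]: "D 0 = 0" using D_add[of 0 0] by simp
lemma D_diff: "D (x - y) = D x - D y" using D_add[of "x - y" y] by simp
lemma D_sum: "D (sum g S) = (\<Sum>i\<in>S. D (g i))" using additive_sum[of D] D_add by blast
lemma D_zmul: "D (zmul r x) = zmul r (D x)" using additive_zmul[of D] D_add by blast

text \<open>\<open>q Z i = ad\<^sub>Z\<^sup>i (D Z)\<close>, and \<open>V Z = ((exp ad\<^sub>Z - 1) / ad\<^sub>Z) (D Z)\<close> is the left logarithmic derivative of \<open>exp Z\<close>.\<close>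

definition q :: "'a \<Rightarrow> nat \<Rightarrow> 'a" where
  "q Z i = ((\<lambda>x. m Z x - m x Z) ^^ i) (D Z)"

definition V :: "'a \<Rightarrow> 'a" where
  "V Z = (\<Sum>i<k. zmul (u (Suc i)) (q Z i))"

lemma q_0 [simp]: "q Z 0 = D Z" by (simp add: q_def)

lemma q_Suc: "q Z (Suc i) = m Z (q Z i) - m (q Z i) Z" by (simp add: q_def)

text \<open>The pre-Lie identity makes left multiplication a Lie homomorphism: [L_Z, L_c] = L_[Z,c],
  here with c = \<open>q Z i\<close>.\<close>

lemma m_q: "m Z (m (q Z i) y) = m (q Z (Suc i)) y + m (q Z i) (m Z y)"
  using prelie[of Z "q Z i" y] by (simp add: q_Suc diff_left algebra_simps)

lemma m_q_self: "m Z (q Z i) = q Z (Suc i) + m (q Z i) Z"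
  by (simp add: q_Suc)

lemma q_F:
  assumes "Z \<in> F 0"
  shows "q Z i \<in> F (Suc i)"
proof (induction i)
  case 0
  then show ?case using D_F F_01 assms by simp
next
  case (Suc i)
  show ?case
    using F_mult[OF F_01[OF assms] Suc] F_mult[OF Suc F_01[OF assms]] by (auto simp: q_Suc intro: F_diff)
qed

lemma V_F0: "Z \<in> F 0 \<Longrightarrow> V Z \<in> F 0"
  unfolding V_def by (intro F_sum F_zmul F_mono[OF q_F]) auto

text \<open>Each factor L_Z in turn is differentiated to L_(D Z), and \<open>m_q\<close> moves the
  result to the left; passing a factor L_Z either leaves it or absorbs it into one more ad_Z. The
  binomials count the ways.\<close>

lemma D_pow:
  "D ((m Z ^^ j) x) = (\<Sum>i<j. zmul (int (j choose Suc i)) (m (q Z i) ((m Z ^^ (j - Suc i)) x))) + (m Z ^^ j) (D x)"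
proof (induction j)
  case 0
  then show ?case by simp
next
  case (Suc j)
  let ?B = "\<lambda>i. m (q Z i) ((m Z ^^ (j - i)) x)"
  have eq: "m Z (m (q Z i) ((m Z ^^ (j - Suc i)) x)) = ?B (Suc i) + ?B i" if "i < j" for i
  proof -
    have "j - i = Suc (j - Suc i)" using that by simp
    then show ?thesis by (simp add: m_q)
  qed
  have "D ((m Z ^^ Suc j) x) = ?B 0 + (\<Sum>i<j. zmul (int (j choose Suc i)) (?B (Suc i) + ?B i)) + (m Z ^^ Suc j) (D x)"
    by (simp add: D_mult Suc add_right sum_right zmul_right eq)
  also have "?B 0 + (\<Sum>i<j. zmul (int (j choose Suc i)) (?B (Suc i) + ?B i)) =
      (\<Sum>i<Suc j. zmul (int (Suc j choose Suc i)) (?B i))"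
    by (rule binomial_sum_step)
  finally show ?case by simp
qed

lemma D_pow_self:
  "D ((m Z ^^ j) Z) = (\<Sum>i<j. zmul (int (Suc j choose Suc i)) (m (q Z i) ((m Z ^^ (j - Suc i)) Z))) + q Z j"
proof (induction j)
  case 0
  then show ?case by simp
next
  case (Suc j)
  \<comment> \<open>The exceptional value at i = Suc j stands for \<open>q Z i\<close> times the
    adjoined unit: Z plays the role of L_Z(1), so the last summand carries no power of Z.\<close>
  define B where "B i = (if i = Suc j then q Z i else m (q Z i) ((m Z ^^ (j - i)) Z))" for i
  have eq: "m Z (m (q Z i) ((m Z ^^ (j - Suc i)) Z)) = B (Suc i) + B i" if "i < j" for i
  proof -
    have "j - i = Suc (j - Suc i)" using that by simp
    then show ?thesis using that by (simp add: m_q B_def)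
  qed
  have top: "m Z (q Z j) = B (Suc j) + B j"
    by (simp add: B_def m_q_self)
  have "D ((m Z ^^ Suc j) Z) = B 0 + (\<Sum>i<Suc j. zmul (int (Suc j choose Suc i)) (B (Suc i) + B i))"
    by (simp add: D_mult Suc add_right sum_right zmul_right eq top binomial_eq_0) (simp add: B_def)
  also have "\<dots> = (\<Sum>i<Suc (Suc j). zmul (int (Suc (Suc j) choose Suc i)) (B i))"
    by (rule binomial_sum_step)
  also have "\<dots> = (\<Sum>i<Suc j. zmul (int (Suc (Suc j) choose Suc i)) (B i)) + B (Suc j)"
    by (subst sum.lessThan_Suc) simp
  also have "(\<Sum>i<Suc j. zmul (int (Suc (Suc j) choose Suc i)) (B i)) =
      (\<Sum>i<Suc j. zmul (int (Suc (Suc j) choose Suc i)) (m (q Z i) ((m Z ^^ (Suc j - Suc i)) Z)))"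
    by (rule sum.cong) (auto simp: B_def)
  also have "B (Suc j) = q Z (Suc j)" by (simp add: B_def)
  finally show ?case .
qed

text \<open>The product is regrouped by j = i + l + 1, and terms with i + l + 1 \<ge> k vanish by
  weight. The case r = 0 serves \<open>E\<close>, the case r = 1 serves \<open>W\<close>.\<close>

lemma dexp_terms:
  assumes "Z \<in> F 0" "x \<in> F 0" "r \<le> 1"
  defines "T \<equiv> \<lambda>i l. zmul (u (Suc i)) (zmul (u (l + r)) (m (q Z i) ((m Z ^^ l) x)))"
  shows "m (V Z) (\<Sum>l<k. zmul (u (l + r)) ((m Z ^^ l) x)) = (\<Sum>j<k. \<Sum>i<j. T i (j - Suc i))"
proof -
  have T0: "T i l = 0" if "k \<le> Suc (i + l)" for i l
  proof -
    have "m (q Z i) ((m Z ^^ l) x) \<in> F (Suc i + (l + Suc 0))"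
      by (intro F_mult q_F pow_F0 F_01 assms)
    then have "m (q Z i) ((m Z ^^ l) x) = 0" using that F_large by auto
    then show ?thesis by (simp add: T_def)
  qed
  have "m (V Z) (\<Sum>l<k. zmul (u (l + r)) ((m Z ^^ l) x)) = (\<Sum>i<k. \<Sum>l<k. T i l)"
    unfolding V_def T_def sum_left by (simp add: sum_right zmul_left zmul_right mult.commute)
  also have "\<dots> = (\<Sum>j<k. \<Sum>i\<le>j. T i (j - i))"
    by (rule sum_square_eq_triangle) (simp add: T0)
  \<comment> \<open>The diagonal j = k - 1 is zero by weight; dropping it makes room for the index
    shift that follows.\<close>
  also have "\<dots> = (\<Sum>j<k - 1. \<Sum>i\<le>j. T i (j - i))"
  proof (rule sum.mono_neutral_right)
    show "\<forall>j\<in>{..<k} - {..<k - 1}. (\<Sum>i\<le>j. T i (j - i)) = 0"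
      by (auto intro!: sum.neutral T0)
  qed auto
  also have "\<dots> = (\<Sum>j<Suc (k - 1). \<Sum>i<j. T i (j - Suc i))"
    by (subst sum.lessThan_Suc_shift) (simp add: lessThan_Suc_atMost del: sum.lessThan_Suc)
  finally show ?thesis using k_ge by simp
qed

lemma D_E:
  assumes "Z \<in> F 0" "x \<in> F 0"
  shows "D (E Z x) = m (V Z) (E Z x) + E Z (D x)"
proof -
  have "D (E Z x) = (\<Sum>j<k. \<Sum>i<j. zmul (u j * int (j choose Suc i)) (m (q Z i) ((m Z ^^ (j - Suc i)) x))) + E Z (D x)"
    by (simp add: E_def D_sum D_zmul D_pow zm.scale_right_distrib sum.distrib zm.scale_sum_right zmul_mult)
  also have "(\<Sum>j<k. \<Sum>i<j. zmul (u j * int (j choose Suc i)) (m (q Z i) ((m Z ^^ (j - Suc i)) x))) =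
      (\<Sum>j<k. \<Sum>i<j. zmul (u (Suc i)) (zmul (u (j - Suc i + 0)) (m (q Z i) ((m Z ^^ (j - Suc i)) x))))"
    using k_less by (intro sum.cong refl) (simp add: u_binomial)
  also have "\<dots> = m (V Z) (\<Sum>l<k. zmul (u (l + 0)) ((m Z ^^ l) x))"
    by (rule dexp_terms[symmetric]) (use assms in auto)
  finally show ?thesis by (simp add: E_def)
qed

text \<open>This is \<open>D_E\<close> at the adjoined unit, which a derivation kills: the
  right-hand side is V Z (1 + W Z).\<close>

lemma D_W:
  assumes "Z \<in> F 0"
  shows "D (W Z) = V Z + m (V Z) (W Z)"
proof -
  have "D (W Z) = (\<Sum>j<k. \<Sum>i<j. zmul (u (Suc j) * int (Suc j choose Suc i)) (m (q Z i) ((m Z ^^ (j - Suc i)) Z))) + V Z"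
    by (simp add: W_def V_def D_sum D_zmul D_pow_self zm.scale_right_distrib sum.distrib zm.scale_sum_right zmul_mult
        del: binomial_Suc_Suc)
  also have "(\<Sum>j<k. \<Sum>i<j. zmul (u (Suc j) * int (Suc j choose Suc i)) (m (q Z i) ((m Z ^^ (j - Suc i)) Z))) =
      (\<Sum>j<k. \<Sum>i<j. zmul (u (Suc i)) (zmul (u (j - Suc i + 1)) (m (q Z i) ((m Z ^^ (j - Suc i)) Z))))"
  proof (intro sum.cong refl, goal_cases)
    case (1 j i)
    then have "Suc j < p" "Suc j - Suc i = j - Suc i + 1" using k_less by auto
    then show ?case by (subst u_binomial) (use 1 in auto)
  qed
  also have "\<dots> = m (V Z) (\<Sum>l<k. zmul (u (l + 1)) ((m Z ^^ l) Z))"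
    by (rule dexp_terms[symmetric]) (use assms in auto)
  finally show ?thesis by (simp add: W_def add.commute)
qed

lemma V_eq_self:
  assumes "D X = X"
  shows "V X = X"
proof -
  have "q X (Suc i) = 0" for i by (induction i) (auto simp: q_Suc assms)
  then have "q X i = 0" if "i \<noteq> 0" for i using that by (cases i) auto
  then have "V X = (\<Sum>i\<in>{0}. zmul (u (Suc i)) (q X i))"
    unfolding V_def using k_ge by (intro sum.mono_neutral_right) auto
  then show ?thesis by (simp add: assms)
qed

lemma V_eq_zero:
  assumes "D Y = 0"
  shows "V Y = 0"
proof -
  have "q Y i = 0" for i by (induction i) (auto simp: q_Suc assms)
  then show ?thesis by (simp add: V_def)
qed

text \<open>Both \<open>E Z\<close> and \<open>E X \<circ> E Y\<close> solve the linear equation \<open>D T = X T\<close>.\<close>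

lemma flow_equation:
  assumes X: "X \<in> F 0" "D X = X" and Y: "Y \<in> F 0" "D Y = 0" and Z: "Z \<in> F 0"
    and W_Z: "W Z = W X + E X (W Y)" and b: "b \<in> F 0" "D b = 0"
  shows "D (E Z b - E X (E Y b)) = m X (E Z b - E X (E Y b))"
proof -
  have DY: "D (W Y) = 0" "D (E Y b) = 0"
    using D_W[OF Y(1)] D_E[OF Y(1) b(1)] by (auto simp: V_eq_zero Y b)
  have EX: "D (E X c) = m X (E X c) + E X (D c)" if "c \<in> F 0" for c
    using D_E[OF X(1) that] by (simp add: V_eq_self X)
  have "D (W Z) = X + m X (W Z)"
    unfolding W_Z D_add using EX[OF W_F0[OF Y(1)]] D_W[OF X(1)]
    by (simp add: V_eq_self X DY add_right algebra_simps)
  then have "V Z + m (V Z) (W Z) = X + m X (W Z)"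
    using D_W[OF Z] by simp
  \<comment> \<open>Written with the unit this is (V Z - X)(1 + W Z) = 0. Multiplication by W Z
    raises the weight, so the factor 1 + W Z can be cancelled.\<close>
  then have uw: "V Z - X = - m (V Z - X) (W Z)"
    by (simp add: diff_left algebra_simps)
  have "V Z - X = 0"
  proof (rule F_converge[OF F_diff[OF V_F0[OF Z] X(1)]])
    fix i assume "V Z - X \<in> F i"
    from F_mult[OF this F_01[OF W_F0[OF Z]]] have "m (V Z - X) (W Z) \<in> F (Suc i)" by simp
    then show "V Z - X \<in> F (Suc i)" using uw F_uminus by metis
  qed
  then have "V Z = X" by simp
  then show ?thesis
    using D_E[OF Z b(1)] EX[OF E_F[OF Y(1) b(1)]] by (simp add: D_diff b DY diff_right)
qed

end

section \<open>Formal power series over a filtered algebra\<close>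

lemma fps_nth_zmul [simp]: "fps_nth (zmul r c) j = zmul r (fps_nth c j)"
  using additive_zmul[of "\<lambda>c. fps_nth c j" r c] by simp

context filtered_algebra
begin

definition fps_m :: "'a fps \<Rightarrow> 'a fps \<Rightarrow> 'a fps" where
  "fps_m c d = Abs_fps (\<lambda>j. \<Sum>i\<le>j. m (fps_nth c i) (fps_nth d (j - i)))"

text \<open>The condition \<open>c\<^sub>j \<in> F j\<close> makes the series finite, so that they can be evaluated at \<open>1\<close>.\<close>

definition fps_F :: "nat \<Rightarrow> 'a fps set" where
  "fps_F i = {c. \<forall>j. fps_nth c j \<in> F (max i j)}"

text \<open>The Euler operator t d/dt. It fixes t x and kills constants, the two cases needed in
  \<open>flow_equation\<close>.\<close>

definition fps_D :: "'a fps \<Rightarrow> 'a fps" where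
  "fps_D c = Abs_fps (\<lambda>j. zmul (int j) (fps_nth c j))"

definition fps_ev :: "'a fps \<Rightarrow> 'a" where
  "fps_ev c = (\<Sum>j<k. fps_nth c j)"

lemma fps_filtered_algebra: "filtered_algebra p n k fps_F fps_m"
proof
  show "zmul (int (p ^ n)) x = 0" for x :: "'a fps"
    by (rule fps_ext) (simp only: fps_nth_zmul torsion fps_zero_nth)
  show "fps_F (Suc i) \<subseteq> fps_F i" for i
    unfolding fps_F_def by (auto intro: F_mono)
  show "a \<in> fps_F k \<Longrightarrow> a = 0" for a
    unfolding fps_F_def by (auto intro!: fps_ext F_large)
  show "fps_F 0 \<subseteq> fps_F 1"
  proof
    fix c assume c: "c \<in> fps_F 0"
    have "fps_nth c j \<in> F (max 1 j)" for j
    proof (cases j)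
      case 0
      have "fps_nth c 0 \<in> F (max 0 0)" using c unfolding fps_F_def by blast
      then show ?thesis using 0 F_01 by simp
    next
      case (Suc i)
      have "fps_nth c j \<in> F (max 0 j)" using c unfolding fps_F_def by blast
      then show ?thesis using Suc by simp
    qed
    then show "c \<in> fps_F 1" unfolding fps_F_def by blast
  qed
  show "fps_m x y \<in> fps_F (i + j)" if "x \<in> fps_F i" "y \<in> fps_F j" for x y i j
  proof -
    have "m (fps_nth x a) (fps_nth y (l - a)) \<in> F (max (i + j) l)" if "a \<le> l" for a l
      using \<open>x \<in> fps_F i\<close> \<open>y \<in> fps_F j\<close> that unfolding fps_F_def
      by (intro F_mono[OF F_mult, of _ "max i a" _ "max j (l - a)"]) auto
    then show ?thesis unfolding fps_F_def fps_m_def by (auto intro: F_sum)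
  qed
qed (use prime_p k_less k_ge in \<open>auto simp: fps_F_def fps_m_def F_zero F_diff add_left add_right sum.distrib intro!: fps_ext\<close>)

text \<open>The truncation at degree k is harmless: a product of coefficients of total degree at
  least k lies deep enough in the filtration to vanish.\<close>

lemma fps_ev_m:
  assumes "c \<in> fps_F 0" "d \<in> fps_F 0"
  shows "fps_ev (fps_m c d) = m (fps_ev c) (fps_ev d)"
proof -
  have nth: "fps_nth c j \<in> F j" "fps_nth d j \<in> F j" for j
    using assms unfolding fps_F_def by (auto dest: spec[of _ j])
  have "m (fps_ev c) (fps_ev d) = (\<Sum>i<k. \<Sum>l<k. m (fps_nth c i) (fps_nth d l))"
    by (simp only: fps_ev_def sum_left) (simp only: sum_right)
  also have "\<dots> = fps_ev (fps_m c d)"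
    unfolding fps_ev_def fps_m_def
    by (subst sum_square_eq_triangle) (auto intro: F_large[OF F_mult[OF nth]])
  finally show ?thesis by simp
qed

text \<open>Meant for two homomorphisms: evaluation at t = 1, and the constant coefficient, which is
  evaluation at t = 0.\<close>

lemma fps_hom_EW:
  assumes h: "\<And>c d. h (c + d) = h c + (h d :: 'a)"
    and hm: "\<And>c d. c \<in> fps_F 0 \<Longrightarrow> d \<in> fps_F 0 \<Longrightarrow> h (fps_m c d) = m (h c) (h d)"
    and c: "c \<in> fps_F 0"
  shows "d \<in> fps_F 0 \<Longrightarrow> h (filtered_algebra.E p n k fps_m c d) = E (h c) (h d)"
    and "h (filtered_algebra.W p n k fps_m c) = W (h c)"
proof -
  interpret B: filtered_algebra p n k fps_F fps_m by (rule fps_filtered_algebra)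
  have pow: "h ((fps_m c ^^ j) x) = (m (h c) ^^ j) (h x)" if "x \<in> fps_F 0" for x j
    by (rule hom_pow[where S = "fps_F 0"]) (use hm c that B.F_mult[of _ 0 _ 0] in auto)
  have sum: "h (sum g S) = (\<Sum>i\<in>S. h (g i))" for g S
    using additive_sum[of h g S] h by blast
  show "h (B.E c d) = E (h c) (h d)" if "d \<in> fps_F 0"
    unfolding B.E_def E_def by (simp add: sum additive_zmul h pow that)
  show "h (B.W c) = W (h c)"
    unfolding B.W_def W_def by (simp add: sum additive_zmul h pow c)
qed

end

context filtered_prelie
begin

lemma fps_prelie_derivation: "filtered_prelie_derivation p n k fps_F fps_m fps_D"
proof -
  interpret B: filtered_algebra p n k fps_F fps_m by (rule fps_filtered_algebra)
  show ?thesis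
  proof
    fix x y z :: "'a fps"
    show "fps_m (fps_m x y) z - fps_m x (fps_m y z) = fps_m (fps_m y x) z - fps_m y (fps_m x z)"
    proof (rule fps_ext)
      fix j
      let ?A = "\<lambda>x y z. m (m x y) z - m x (m y z)"
      \<comment> \<open>A coefficient of the associator is a sum of associators of coefficients; the
        reflection of a to l - a then exchanges x and y.\<close>
      have assoc: "fps_nth (fps_m (fps_m x y) z - fps_m x (fps_m y z)) j =
          (\<Sum>l\<le>j. \<Sum>a\<le>l. ?A (fps_nth x a) (fps_nth y (l - a)) (fps_nth z (j - l)))" for x y
        using fps_mult_assoc_lemma[of "\<lambda>a b c. m (fps_nth x a) (m (fps_nth y b) (fps_nth z c))" j j]
        by (simp add: fps_m_def sum_left sum_right sum_subtractf atMost_atLeast0)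
      have "(\<Sum>a\<le>l. ?A (fps_nth x a) (fps_nth y (l - a)) c) =
          (\<Sum>a\<le>l. ?A (fps_nth y a) (fps_nth x (l - a)) c)" for l c
        by (rule sum.reindex_bij_witness[of _ "\<lambda>a. l - a" "\<lambda>a. l - a"]) (auto simp: prelie)
      then show "fps_nth (fps_m (fps_m x y) z - fps_m x (fps_m y z)) j =
          fps_nth (fps_m (fps_m y x) z - fps_m y (fps_m x z)) j"
        unfolding assoc by simp
    qed
    show "fps_D (x + y) = fps_D x + fps_D y"
      by (rule fps_ext) (simp add: fps_D_def zm.scale_right_distrib)
    show "x \<in> fps_F i \<Longrightarrow> fps_D x \<in> fps_F i" for i
      by (auto simp: fps_F_def fps_D_def intro: F_zmul)
    show "fps_D (fps_m x y) = fps_m (fps_D x) y + fps_m x (fps_D y)"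
    proof (rule fps_ext)
      fix j
      have "(\<Sum>i\<le>j. zmul (int j) (m (fps_nth x i) (fps_nth y (j - i)))) =
          (\<Sum>i\<le>j. zmul (int i) (m (fps_nth x i) (fps_nth y (j - i))) + zmul (int (j - i)) (m (fps_nth x i) (fps_nth y (j - i))))"
        by (intro sum.cong refl) (simp add: zmul_add_left[symmetric] of_nat_diff)
      then show "fps_nth (fps_D (fps_m x y)) j = fps_nth (fps_m (fps_D x) y + fps_m x (fps_D y)) j"
        by (simp add: fps_D_def fps_m_def zm.scale_sum_right zmul_left zmul_right sum.distrib)
    qed
  qed
qed

text \<open>With X = t x and y constant, the series Z defined by W Z = W X + E X (W y) runs from y
  at t = 0 to z at t = 1. The difference d of the two flows satisfies D d = X d and d(0) = 0, hence
  vanishes.\<close>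

lemma E_compose:
  assumes x: "x \<in> F 0" and y: "y \<in> F 0" and z: "z \<in> F 0" and b: "b \<in> F 0"
    and W_z: "W z = W x + E x (W y)"
  shows "E z b = E x (E y b)"
proof -
  interpret B: filtered_prelie_derivation p n k fps_F fps_m fps_D by (rule fps_prelie_derivation)
  define X where "X = Abs_fps (\<lambda>j. if j = 1 then x else 0)"
  define C where "C b = Abs_fps (\<lambda>j. if j = 0 then b else 0)" for b :: 'a
  have X: "X \<in> fps_F 0" "fps_D X = X"
    using x F_01 F_zero by (auto simp: X_def fps_F_def fps_D_def intro!: fps_ext)
  have C: "C b \<in> fps_F 0" "fps_D (C b) = 0" if "b \<in> F 0" for b
    using that F_zero by (auto simp: C_def fps_F_def fps_D_def intro!: fps_ext)
  have ev_add: "fps_ev (c + d) = fps_ev c + fps_ev d" for c d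
    by (simp add: fps_ev_def sum.distrib)
  have ev: "fps_ev X = x" "fps_ev (C b) = b" for b
    using k_ge by (auto simp: fps_ev_def X_def C_def)
  have nth0_m: "fps_nth (fps_m c d) 0 = m (fps_nth c 0) (fps_nth d 0)" for c d
    by (simp add: fps_m_def)
  have ev_hom: "d \<in> fps_F 0 \<Longrightarrow> fps_ev (B.E c d) = E (fps_ev c) (fps_ev d)" "fps_ev (B.W c) = W (fps_ev c)"
    if "c \<in> fps_F 0" for c d
    by (rule fps_hom_EW; use that ev_add fps_ev_m in simp)+
  have nth_hom: "d \<in> fps_F 0 \<Longrightarrow> fps_nth (B.E c d) 0 = E (fps_nth c 0) (fps_nth d 0)" "fps_nth (B.W c) 0 = W (fps_nth c 0)"
    if "c \<in> fps_F 0" for c d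
    by (rule fps_hom_EW[where h = "\<lambda>c. fps_nth c 0"]; use that nth0_m in simp)+
  note WY = B.W_F0[OF C(1)[OF y]]
  obtain Z where Z: "Z \<in> fps_F 0" and W_Z: "B.W Z = B.W X + B.E X (B.W (C y))"
    using B.W_surj[OF B.F_add[OF B.W_F0[OF X(1)] B.E_F[OF X(1) WY]]] by metis
  have ev_F: "fps_ev c \<in> F 0" if "c \<in> fps_F 0" for c
    using that unfolding fps_ev_def fps_F_def by (auto intro!: F_sum intro: F_mono)
  have "W (fps_ev Z) = fps_ev (B.W X + B.E X (B.W (C y)))"
    using ev_hom(2)[OF Z] W_Z by simp
  also have "\<dots> = W z"
    using ev_hom(2)[OF X(1)] ev_hom(1)[OF X(1) WY] ev_hom(2)[OF C(1)[OF y]]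
    by (simp add: ev_add ev W_z)
  finally have ev_Z: "fps_ev Z = z"
    using W_inj ev_F Z z by blast
  have X0: "fps_nth X 0 = 0" by (simp add: X_def)
  have C0: "fps_nth (C b) 0 = b" for b by (simp add: C_def)
  have "W (fps_nth Z 0) = fps_nth (B.W X + B.E X (B.W (C y))) 0"
    using nth_hom(2)[OF Z] W_Z by simp
  also have "\<dots> = W y"
    using nth_hom(2)[OF X(1)] nth_hom(1)[OF X(1) WY] nth_hom(2)[OF C(1)[OF y]]
    by (simp add: X0 C0)
  finally have Z0: "fps_nth Z 0 = y"
    using W_inj[of "fps_nth Z 0" y] y Z unfolding fps_F_def by (auto dest: spec[of _ 0])
  define d where "d = B.E Z (C b) - B.E X (B.E (C y) (C b))"
  note EY = B.E_F[OF C(1)[OF y] C(1)[OF b]]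
  have d_F: "d \<in> fps_F 0"
    unfolding d_def using B.E_F[OF Z C(1)[OF b]] B.E_F[OF X(1) EY] by (rule B.F_diff)
  have d0: "fps_nth d 0 = 0"
    using nth_hom(1)[OF Z C(1)[OF b]] nth_hom(1)[OF X(1) EY] nth_hom(1)[OF C(1)[OF y] C(1)[OF b]]
    by (simp add: d_def X0 C0 Z0)
  have Dd: "fps_D d = fps_m X d"
    unfolding d_def by (rule B.flow_equation) (use X C y Z W_Z b in auto)
  have step: "zmul (int (Suc j)) (fps_nth d (Suc j)) = m x (fps_nth d j)" for j
  proof -
    have "fps_nth (fps_m X d) (Suc j) = (\<Sum>i\<le>Suc j. if i = 1 then m x (fps_nth d j) else 0)"
      unfolding fps_m_def fps_nth_Abs_fps by (intro sum.cong refl) (auto simp: X_def)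
    also have "\<dots> = m x (fps_nth d j)" by (subst sum.delta) auto
    finally show ?thesis using Dd by (metis fps_D_def fps_nth_Abs_fps)
  qed
  have "fps_nth d j = 0" for j
  proof (induction j)
    case 0
    then show ?case by (rule d0)
  next
    case (Suc j)
    show ?case
    \<comment> \<open>Below k the factor j + 1 is less than p and can be cancelled; from k on the
      weight alone forces the coefficient to be zero.\<close>
    proof (cases "Suc j < k")
      case True
      then have "Suc j < p" using k_less by simp
      then show ?thesis using nat_cancel[of "Suc j" "fps_nth d (Suc j)" 0] step[of j] Suc by simp
    next
      case False
      have "fps_nth d (Suc j) \<in> F (max 0 (Suc j))" using d_F unfolding fps_F_def by blast
      then show ?thesis using False F_large by auto
    qed
  qed
  then have "d = 0" by (auto intro: fps_ext)
  then have "fps_ev (B.E Z (C b)) = fps_ev (B.E X (B.E (C y) (C b)))" by (simp add: d_def)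
  then show ?thesis
    using ev_hom(1)[OF Z C(1)[OF b]] ev_hom(1)[OF X(1) EY] ev_hom(1)[OF C(1)[OF y] C(1)[OF b]]
    by (simp add: ev ev_Z)
qed

end

section \<open>Polynomial paths and coefficient extraction\<close>

lemma cong_power_prime_lift:
  fixes x :: int
  assumes "[x = 1] (mod int p)"
  shows "[x ^ (p ^ r) = 1] (mod int p ^ Suc r)"
proof (induction r)
  case 0
  then show ?case using assms by simp
next
  case (Suc r)
  let ?y = "x ^ (p ^ r)"
  have "int p dvd int p ^ Suc r" by simp
  with Suc have "[?y = 1] (mod int p)" by (rule cong_dvd_modulus)
  then have "[?y ^ i = 1 ^ i] (mod int p)" for i by (rule cong_pow)
  \<comment> \<open>In y^p - 1 = (y - 1)(1 + y + ... + y^(p-1)) the second factor is congruent to p,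
    hence to 0, modulo p; so each p-th power gains one power of p.\<close>
  then have "[(\<Sum>i<p. ?y ^ i) = (\<Sum>i<p. 1)] (mod int p)" by (intro cong_sum) simp
  from cong_dvd_iff[OF this] have "int p dvd (\<Sum>i<p. ?y ^ i)" by simp
  moreover have "int p ^ Suc r dvd ?y - 1" using Suc by (simp add: cong_iff_dvd_diff)
  ultimately have "int p ^ Suc r * int p dvd (?y - 1) * (\<Sum>i<p. ?y ^ i)" by (rule mult_dvd_mono[rotated])
  then show ?case
    unfolding power_diff_1_eq[symmetric]
    by (simp add: cong_iff_dvd_diff power_mult[symmetric] mult.commute)
qed

text \<open>As \<gamma> has order p^(p-1) (p - 1), its power x has order p - 1 modulo p^p. The order
  modulo p is no smaller: x^d = 1 modulo p lifts to x^(d p^(p-1)) = 1 modulo p^p, and p - 1 is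
  coprime to p.\<close>

lemma primroot_root_of_unity:
  fixes p \<gamma> :: nat
  assumes p: "prime p" and \<gamma>: "residue_primroot (p ^ p) \<gamma>"
  defines "x \<equiv> int (\<gamma> ^ (p ^ (p - 1)))"
  shows "[x ^ (p - 1) = 1] (mod int p ^ p)"
    and "[x ^ d = 1] (mod int p) \<Longrightarrow> (p - 1) dvd d"
    and "\<not> int p dvd x"
proof -
  have cop: "coprime \<gamma> (p ^ p)" and ord: "ord (p ^ p) \<gamma> = p ^ (p - 1) * (p - 1)"
    using \<gamma> p prime_gt_0_nat[OF p]
    by (auto simp: residue_primroot_def coprime_commute totient_prime_power)
  have "[\<gamma> ^ (p ^ (p - 1) * (p - 1)) = 1] (mod p ^ p)"
    using ord by (subst ord_divides) simp
  then have "[int (\<gamma> ^ (p ^ (p - 1) * (p - 1))) = int 1] (mod int (p ^ p))"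
    by (simp only: cong_int_iff)
  then show "[x ^ (p - 1) = 1] (mod int p ^ p)"
    by (simp add: x_def power_mult)
  have "coprime \<gamma> p"
    using cop prime_gt_0_nat[OF p] by simp
  then have "\<not> p dvd \<gamma>"
    using p coprime_common_divisor[of \<gamma> p p] by (auto simp: prime_nat_iff)
  then show "\<not> int p dvd x"
    unfolding x_def using p by (meson int_dvd_int_iff prime_dvd_power)
  assume "[x ^ d = 1] (mod int p)"
  then have "[(x ^ d) ^ (p ^ (p - 1)) = 1] (mod int p ^ Suc (p - 1))"
    by (rule cong_power_prime_lift)
  then have "[int (\<gamma> ^ (p ^ (p - 1) * d * p ^ (p - 1))) = int 1] (mod int (p ^ p))"
    using prime_gt_0_nat[OF p] by (simp add: x_def power_mult)
  then have "[\<gamma> ^ (p ^ (p - 1) * d * p ^ (p - 1)) = 1] (mod p ^ p)"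
    by (simp only: cong_int_iff)
  then have "p ^ (p - 1) * (p - 1) dvd p ^ (p - 1) * (d * p ^ (p - 1))"
    by (simp only: ord_divides ord mult.assoc)
  then have "p - 1 dvd d * p ^ (p - 1)"
    using prime_gt_0_nat[OF p] by simp
  moreover have "coprime (p - 1) (p ^ (p - 1))"
    using coprime_diff_one_left_nat[OF prime_gt_0_nat[OF p]] by simp
  ultimately show "p - 1 dvd d"
    by (simp add: coprime_dvd_mult_left_iff)
qed

text \<open>For j \<noteq> e this is a geometric sum: multiplied by x^j - x^e it telescopes to 0,
  and that factor is a unit modulo p^n because p - 1 does not divide j - e.\<close>

lemma root_of_unity_sum:
  fixes p \<gamma> :: nat
  assumes p: "prime p" and \<gamma>: "residue_primroot (p ^ p) \<gamma>" and "n \<le> p" "j < p - 1" "e < p - 1"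
  defines "x \<equiv> int (\<gamma> ^ (p ^ (p - 1)))"
  shows "[(\<Sum>i<p - 1. x ^ ((p - 1 - i) * e + i * j)) = (if j = e then int p - 1 else 0)] (mod int (p ^ n))"
proof -
  note x = primroot_root_of_unity[OF p \<gamma>, folded x_def]
  have "int p ^ n dvd int p ^ p" using \<open>n \<le> p\<close> by (rule le_imp_power_dvd)
  with x(1) have "[x ^ (p - 1) = 1] (mod int p ^ n)" by (rule cong_dvd_modulus)
  then have x1: "[x ^ ((p - 1) * i) = 1] (mod int p ^ n)" for i
    using cong_pow[of "x ^ (p - 1)" 1 "int p ^ n" i] by (simp add: power_mult)
  let ?T = "\<lambda>i. x ^ ((p - 1 - i) * e + i * j)"
  show ?thesis
  proof (cases "j = e")
    case True
    have "[(\<Sum>i<p - 1. ?T i) = (\<Sum>i<p - 1. 1)] (mod int p ^ n)"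
    proof (rule cong_sum)
      fix i assume "i \<in> {..<p - 1}"
      then have "(p - 1 - i) * e + i * j = (p - 1) * e"
        using True by (simp add: add_mult_distrib[symmetric])
      then show "[?T i = 1] (mod int p ^ n)" using x1 by simp
    qed
    then show ?thesis using True prime_gt_0_nat[OF p] by (simp add: of_nat_diff)
  next
    case False
    have "x ^ j * (\<Sum>i<p - 1. ?T i) = (\<Sum>i<p - 1. x ^ e * ?T (Suc i))"
      unfolding sum_distrib_left
    proof (intro sum.cong refl)
      fix i assume "i \<in> {..<p - 1}"
      then have "p - 1 - i = Suc (p - 1 - Suc i)" by auto
      then show "x ^ j * ?T i = x ^ e * ?T (Suc i)"
        by (simp add: power_add[symmetric] algebra_simps)
    qed
    then have "(x ^ j - x ^ e) * (\<Sum>i<p - 1. ?T i) = x ^ e * (\<Sum>i<p - 1. ?T (Suc i) - ?T i)"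
      by (simp add: sum_distrib_left[symmetric] sum_subtractf algebra_simps)
    also have "\<dots> = x ^ e * (?T (p - 1) - ?T 0)"
      by (rule arg_cong[OF sum_lessThan_telescope[of ?T]])
    also have "[\<dots> = x ^ e * (1 - 1)] (mod int p ^ n)"
      using x1[of j] x1[of e] by (intro cong_mult cong_diff) simp_all
    finally have "[(x ^ j - x ^ e) * (\<Sum>i<p - 1. ?T i) = 0] (mod int p ^ n)" by simp
    moreover have "coprime (x ^ j - x ^ e) (int p ^ n)"
    proof -
      have *: "\<not> int p dvd x ^ (a + d) - x ^ a" if "0 < d" "d < p - 1" for a d
      proof
        assume "int p dvd x ^ (a + d) - x ^ a"
        then have "int p dvd x ^ a * (x ^ d - 1)" by (simp add: power_add algebra_simps)
        then have "int p dvd x ^ d - 1"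
          using x(3) p by (metis prime_dvd_mult_iff prime_dvd_power prime_nat_int_transfer)
        then have "p - 1 dvd d" using x(2)[of d] by (simp add: cong_iff_dvd_diff)
        then show False using that by (simp add: nat_dvd_not_less)
      qed
      have "\<not> int p dvd x ^ j - x ^ e"
      proof (cases "j < e")
        case True
        then show ?thesis using *[of "e - j" j] \<open>e < p - 1\<close> by (simp add: dvd_diff_commute)
      next
        case False
        then show ?thesis using *[of "j - e" e] \<open>j \<noteq> e\<close> \<open>j < p - 1\<close> by simp
      qed
      then have "coprime (int p) (x ^ j - x ^ e)"
        using p by (simp add: prime_imp_coprime)
      then show ?thesis by (simp add: coprime_commute)
    qed
    ultimately have "[(\<Sum>i<p - 1. ?T i) = 0] (mod int p ^ n)"
      by (simp add: cong_0_iff coprime_commute coprime_dvd_mult_right_iff)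
    then show ?thesis using False by simp
  qed
qed

text \<open>The coefficients of the polynomial \<open>t (t - 1) \<dots> (t - l + 1)\<close>.\<close>

fun falling_coeff :: "nat \<Rightarrow> nat \<Rightarrow> int" where
  "falling_coeff 0 j = (if j = 0 then 1 else 0)"
| "falling_coeff (Suc l) j =
    (if j = 0 then 0 else falling_coeff l (j - 1)) - int l * falling_coeff l j"

lemma falling_coeff_large: "l < j \<Longrightarrow> falling_coeff l j = 0"
  by (induction l arbitrary: j) auto

lemma falling_coeff_zero: "l > 0 \<Longrightarrow> falling_coeff l 0 = 0"
proof (induction l)
  case (Suc l)
  then show ?case by (cases l) auto
qed simp

lemma falling_coeff_sum:
  assumes "l < M"
  shows "(\<Sum>j<M. falling_coeff l j * int t ^ j) = int (fact l * (t choose l))"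
  using assms
proof (induction l arbitrary: M)
  case 0
  then show ?case by (simp add: if_distrib[of "\<lambda>x. x * _"] cong: if_cong)
next
  case (Suc l)
  obtain N where M: "M = Suc N" using Suc.prems by (cases M) auto
  have "(\<Sum>j<M. falling_coeff (Suc l) j * int t ^ j) =
      (\<Sum>j<M. (if j = 0 then 0 else falling_coeff l (j - 1)) * int t ^ j) -
      int l * (\<Sum>j<M. falling_coeff l j * int t ^ j)"
    by (simp add: algebra_simps sum_subtractf sum_distrib_left)
  also have "(\<Sum>j<M. (if j = 0 then 0 else falling_coeff l (j - 1)) * int t ^ j) =
      int t * (\<Sum>j<N. falling_coeff l j * int t ^ j)"
    unfolding M by (subst sum.lessThan_Suc_shift) (simp add: sum_distrib_left algebra_simps)
  also have "(\<Sum>j<N. falling_coeff l j * int t ^ j) = int (fact l * (t choose l))"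
    using Suc M by simp
  also have "(\<Sum>j<M. falling_coeff l j * int t ^ j) = int (fact l * (t choose l))"
    using Suc by simp
  also have "int t * int (fact l * (t choose l)) - int l * int (fact l * (t choose l)) =
      int (fact (Suc l) * (t choose Suc l))"
  proof (cases "l \<le> t")
    case True
    have "Suc l * (t choose Suc l) = (t - l) * (t choose l)"
      using binomial_absorption[of l t] binomial_absorb_comp[of t l] by simp
    then have "fact (Suc l) * (t choose Suc l) = (t - l) * (fact l * (t choose l))"
      by (metis fact_Suc mult.assoc mult.commute of_nat_id)
    then have "int (fact (Suc l) * (t choose Suc l)) = (int t - int l) * int (fact l * (t choose l))"
      using True by (metis of_nat_diff of_nat_mult)
    then show ?thesis by (simp add: algebra_simps)
  qed (simp add: binomial_eq_0)
  finally show ?case .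
qed

text \<open>Pascal's rule in the form of the induction step for Newton's formula; B M = 0 removes
  the boundary term.\<close>

lemma binomial_shift_sum:
  fixes B :: "nat \<Rightarrow> 'a::ab_group_add"
  assumes "B M = 0"
  shows "(\<Sum>l<M. zmul (int (Suc t choose l)) (B l)) = (\<Sum>l<M. zmul (int (t choose l)) (B l + B (Suc l)))"
proof -
  have "(\<Sum>l<M. zmul (int (Suc t choose l)) (B l)) = (\<Sum>l<Suc M. zmul (int (Suc t choose l)) (B l))"
    using assms by simp
  also have "\<dots> = (B 0 + (\<Sum>l<M. zmul (int (t choose Suc l)) (B (Suc l)))) + (\<Sum>l<M. zmul (int (t choose l)) (B (Suc l)))"
    by (subst sum.lessThan_Suc_shift) (simp add: zmul_add_left sum.distrib add_ac)
  also have "B 0 + (\<Sum>l<M. zmul (int (t choose Suc l)) (B (Suc l))) = (\<Sum>l<Suc M. zmul (int (t choose l)) (B l))"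
    by (subst sum.lessThan_Suc_shift) simp
  finally show ?thesis using assms
    by (simp add: zm.scale_right_distrib sum.distrib algebra_simps)
qed

locale primroot_filtration = torsion_filtration p n k F
  for p n k and F :: "nat \<Rightarrow> 'a::ab_group_add set" +
  fixes \<gamma> :: nat
  assumes primroot: "residue_primroot (p ^ p) \<gamma>" and n_le: "n \<le> p" and F_0: "F 0 = UNIV"
begin

lemma F_1: "F (Suc 0) = UNIV"
  using F_01 F_0 by blast

abbreviation \<xi> :: nat where "\<xi> \<equiv> \<gamma> ^ (p ^ (p - 1))"

text \<open>For \<open>e = 1\<close> this is the operator occurring in the associated pre-Lie product.  It reads off the coefficient
  of \<open>t ^ e\<close> because \<open>\<xi>\<close> has order \<open>p - 1\<close> modulo every power of \<open>p\<close> up to \<open>p ^ p\<close>, and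
  \<open>(1 + p + \<dots> + p ^ (n - 1)) (p - 1) = p ^ n - 1\<close>.\<close>

definition coef :: "nat \<Rightarrow> (nat \<Rightarrow> 'a) \<Rightarrow> 'a" where
  "coef e \<phi> = zmul (- int (\<Sum>i<n. p ^ i)) (\<Sum>i<p - 1. zmul (int (\<xi> ^ ((p - 1 - i) * e))) (\<phi> (\<xi> ^ i)))"

lemma coef_add: "coef e (\<lambda>t. \<phi> t + \<psi> t) = coef e \<phi> + coef e \<psi>"
  by (simp add: coef_def zm.scale_right_distrib sum.distrib)

lemma coef_zero: "coef e (\<lambda>t. 0) = 0"
  by (simp add: coef_def)

lemma coef_sum: "coef e (\<lambda>t. \<Sum>i\<in>S. \<phi> i t) = (\<Sum>i\<in>S. coef e (\<phi> i))"
  by (induction S rule: infinite_finite_induct) (simp_all add: coef_add coef_zero)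

lemma coef_additive:
  assumes "\<And>x y. f (x + y) = f x + f y"
  shows "coef e (\<lambda>t. f (\<phi> t)) = f (coef e \<phi>)"
  by (simp only: coef_def additive_zmul[of f, OF assms] conjunct1[OF additive_sum[of f, OF assms]])

lemma coef_zmul: "coef e (\<lambda>t. zmul r (\<phi> t)) = zmul r (coef e \<phi>)"
  by (rule coef_additive) (rule zmul_add_right)

lemma coef_swap: "coef e (\<lambda>s. coef d (\<lambda>t. \<phi> s t)) = coef d (\<lambda>t. coef e (\<lambda>s. \<phi> s t))"
  by (simp only: coef_def[of e] coef_zmul coef_sum)

lemma coef_monom:
  assumes "j < p - 1" "e < p - 1"
  shows "coef e (\<lambda>t. zmul (int t ^ j) c) = (if j = e then c else 0)"
proof -
  have "coef e (\<lambda>t. zmul (int t ^ j) c) =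
      zmul (- int (\<Sum>i<n. p ^ i)) (zmul (\<Sum>i<p - 1. int \<xi> ^ ((p - 1 - i) * e + i * j)) c)"
    by (simp add: coef_def zm.scale_sum_left power_add power_mult)
  also have "\<dots> = zmul (- int (\<Sum>i<n. p ^ i)) (zmul (if j = e then int p - 1 else 0) c)"
    using zmul_cong[OF root_of_unity_sum[OF prime_p primroot n_le assms]] by simp
  also have "\<dots> = (if j = e then zmul (1 - int (p ^ n)) c else 0)"
  proof -
    have "- int (\<Sum>i<n. p ^ i) * (int p - 1) = 1 - int (p ^ n)"
      using power_diff_1_eq[of "int p" n] by (simp add: algebra_simps)
    then show ?thesis by (simp only: zmul_mult zm.scale_zero_left zm.scale_zero_right split: if_split) simp
  qed
  also have "\<dots> = (if j = e then c else 0)"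
    using torsion[of c] by (simp add: zm.scale_left_diff_distrib)
  finally show ?thesis .
qed

lemma k_le: "j < k \<Longrightarrow> j < p - 1"
  using k_less by simp

lemma coef_poly:
  assumes "e < k"
  shows "coef e (\<lambda>t. \<Sum>j<k. zmul (int t ^ j) (c j)) = c e"
proof -
  have "coef e (\<lambda>t. \<Sum>j<k. zmul (int t ^ j) (c j)) = (\<Sum>j<k. if j = e then c j else 0)"
    unfolding coef_sum by (intro sum.cong refl coef_monom) (use k_le assms in auto)
  then show ?thesis using assms by simp
qed

text \<open>The right-hand side is the derivative at t. This turns the law x(s + t) = x(s) o x(t) of
  circle powers into a differential equation.\<close>

lemma coef_translate:
  "coef 1 (\<lambda>s. \<Sum>j<k. zmul (int (s + t) ^ j) (c j)) = (\<Sum>j<k. zmul (int j * int t ^ (j - 1)) (c j))"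
  unfolding coef_sum
proof (intro sum.cong refl)
  fix j assume j: "j \<in> {..<k}"
  have "coef 1 (\<lambda>s. zmul (int (s + t) ^ j) (c j)) =
      coef 1 (\<lambda>s. \<Sum>i\<le>j. zmul (int s ^ i) (zmul (int (j choose i) * int t ^ (j - i)) (c j)))"
    by (simp add: binomial_ring zm.scale_sum_left algebra_simps)
  also have "\<dots> = (\<Sum>i\<le>j. if i = 1 then zmul (int (j choose i) * int t ^ (j - i)) (c j) else 0)"
    unfolding coef_sum by (intro sum.cong refl coef_monom) (use j k_le k_ge in auto)
  also have "\<dots> = zmul (int j * int t ^ (j - 1)) (c j)"
    by (cases "j = 0") (auto simp: sum.delta)
  finally show "coef 1 (\<lambda>s. zmul (int (s + t) ^ j) (c j)) = zmul (int j * int t ^ (j - 1)) (c j)" .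
qed

text \<open>Polynomial paths whose coefficients gain weight with their degree. Only the value and
  the derivative at 0 are recorded, since linear coefficients are all that the pre-Lie product
  sees.\<close>

definition expand :: "nat \<Rightarrow> (nat \<Rightarrow> 'a) \<Rightarrow> 'a \<Rightarrow> 'a \<Rightarrow> bool" where
  "expand s \<phi> a b \<longleftrightarrow> (\<exists>c. (\<forall>j. c j \<in> F (s + j)) \<and>
     (\<forall>t. \<phi> t = (\<Sum>j<k. zmul (int t ^ j) (c j))) \<and> c 0 = a \<and> c 1 = b)"

lemma expand_coef:
  assumes "expand s \<phi> a b"
  shows "coef 1 \<phi> = b"
proof -
  obtain c where "\<phi> = (\<lambda>t. \<Sum>j<k. zmul (int t ^ j) (c j))" "c 1 = b"
    using assms unfolding expand_def by blast
  then show ?thesis using coef_poly[of 1 c] k_ge by simp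
qed

lemma expand_add:
  assumes "expand s \<phi> a b" "expand s \<psi> a' b'"
  shows "expand s (\<lambda>t. \<phi> t + \<psi> t) (a + a') (b + b')"
proof -
  obtain c where c: "\<And>j. c j \<in> F (s + j)" "\<And>t. \<phi> t = (\<Sum>j<k. zmul (int t ^ j) (c j))" "c 0 = a" "c 1 = b"
    using assms(1) unfolding expand_def by blast
  obtain d where d: "\<And>j. d j \<in> F (s + j)" "\<And>t. \<psi> t = (\<Sum>j<k. zmul (int t ^ j) (d j))" "d 0 = a'" "d 1 = b'"
    using assms(2) unfolding expand_def by blast
  show ?thesis unfolding expand_def
    by (rule exI[of _ "\<lambda>j. c j + d j"]) (use c d F_add in \<open>auto simp: zm.scale_right_distrib sum.distrib\<close>)
qed

lemma expand_const:
  assumes "b \<in> F s"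
  shows "expand s (\<lambda>t. b) b 0"
  unfolding expand_def
proof (intro exI[of _ "\<lambda>j. if j = 0 then b else 0"] conjI allI)
  show "b = (\<Sum>j<k. zmul (int t ^ j) (if j = 0 then b else 0))" for t
    using k_ge by (simp add: if_distrib[of "zmul _"] cong: if_cong)
qed (use assms F_zero in auto)

lemma expand_sum:
  assumes "finite S" "\<And>i. i \<in> S \<Longrightarrow> expand s (\<phi> i) (a i) (b i)"
  shows "expand s (\<lambda>t. \<Sum>i\<in>S. \<phi> i t) (\<Sum>i\<in>S. a i) (\<Sum>i\<in>S. b i)"
  using assms by (induction S rule: finite_induct) (auto intro: expand_add expand_const[OF F_zero])

lemma expand_additive:
  assumes f: "\<And>x y. f (x + y) = f x + f y" and fF: "\<And>x j. x \<in> F (s + j) \<Longrightarrow> f x \<in> F (s' + j)"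
    and "expand s \<phi> a b"
  shows "expand s' (\<lambda>t. f (\<phi> t)) (f a) (f b)"
proof -
  obtain c where c: "\<And>j. c j \<in> F (s + j)" "\<And>t. \<phi> t = (\<Sum>j<k. zmul (int t ^ j) (c j))" "c 0 = a" "c 1 = b"
    using assms(3) unfolding expand_def by blast
  show ?thesis unfolding expand_def
    by (rule exI[of _ "\<lambda>j. f (c j)"])
      (use c fF in \<open>auto simp: additive_zmul[of f, OF f] conjunct1[OF additive_sum[of f, OF f]]\<close>)
qed

lemma expand_shift:
  assumes "expand (s + i) \<phi> a b"
  shows "expand s (\<lambda>t. zmul (int t ^ i) (\<phi> t)) (if i = 0 then a else 0) (if i = 0 then b else if i = 1 then a else 0)"
proof -
  obtain c where c: "\<And>j. c j \<in> F (s + i + j)" "\<And>t. \<phi> t = (\<Sum>j<k. zmul (int t ^ j) (c j))" "c 0 = a" "c 1 = b"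
    using assms unfolding expand_def by blast
  let ?c = "\<lambda>j. if j < i then 0 else c (j - i)"
  have "zmul (int t ^ i) (\<phi> t) = (\<Sum>j<k. zmul (int t ^ j) (?c j))" for t
  proof -
    have "zmul (int t ^ i) (\<phi> t) = (\<Sum>j<k. zmul (int t ^ (j + i)) (?c (j + i)))"
      by (simp add: c zm.scale_sum_right power_add mult.commute)
    also have "\<dots> = (\<Sum>j\<in>{i..<k + i}. zmul (int t ^ j) (?c j))"
      using sum.shift_bounds_nat_ivl[of "\<lambda>j. zmul (int t ^ j) (?c j)" 0 i k] by (simp add: atLeast0LessThan)
    also have "\<dots> = (\<Sum>j\<in>{..<k + i}. zmul (int t ^ j) (?c j))"
      by (rule sum.mono_neutral_left) auto
    also have "\<dots> = (\<Sum>j<k. zmul (int t ^ j) (?c j))"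
    \<comment> \<open>A coefficient pushed to degree j by the shift has weight at least j, so those
      reaching degree k or beyond are zero.\<close>
    proof (rule sum.mono_neutral_right)
      show "\<forall>j\<in>{..<k + i} - {..<k}. zmul (int t ^ j) (?c j) = 0"
      proof
        fix j assume j: "j \<in> {..<k + i} - {..<k}"
        have "?c j = 0" if "\<not> j < i" using F_large[OF c(1)[of "j - i"]] that j by simp
        then show "zmul (int t ^ j) (?c j) = 0" by auto
      qed
    qed auto
    finally show ?thesis .
  qed
  moreover have "?c j \<in> F (s + j)" for j
    using c(1)[of "j - i"] F_zero by (auto simp: add.assoc)
  ultimately show ?thesis unfolding expand_def
    by (intro exI[of _ ?c]) (use c in auto)
qed

lemma expand_linear: "expand 0 (\<lambda>t. zmul (int t) a) 0 a"
  using expand_shift[of 0 1 "\<lambda>t. a" a 0] expand_const[of a 1] F_1 by simp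

text \<open>C(t,l) is t (t - 1) ... (t - l + 1) divided by l!, which is legitimate as l < k < p. The
  coefficient of t^j involves only \<open>e l\<close> with l \<ge> j, so weights survive the change
  of basis.\<close>

lemma binomial_to_power:
  fixes e :: "nat \<Rightarrow> 'a"
  shows "(\<Sum>l<k. zmul (int (t choose l)) (e l)) =
    (\<Sum>j<k. zmul (int t ^ j) (\<Sum>l\<in>{j..<k}. zmul (u l * falling_coeff l j) (e l)))"
proof -
  have "(\<Sum>j<k. zmul (int t ^ j) (\<Sum>l\<in>{j..<k}. zmul (u l * falling_coeff l j) (e l))) =
      (\<Sum>j<k. zmul (int t ^ j) (\<Sum>l<k. zmul (u l * falling_coeff l j) (e l)))"
    by (intro sum.cong refl arg_cong[of _ _ "zmul _"] sum.mono_neutral_left) (auto simp: falling_coeff_large)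
  also have "\<dots> = (\<Sum>l<k. \<Sum>j<k. zmul (int t ^ j) (zmul (u l * falling_coeff l j) (e l)))"
    by (simp only: zm.scale_sum_right) (rule sum.swap)
  also have "\<dots> = (\<Sum>l<k. zmul (u l * (\<Sum>j<k. falling_coeff l j * int t ^ j)) (e l))"
    by (simp add: sum_distrib_left zm.scale_sum_left algebra_simps)
  also have "\<dots> = (\<Sum>l<k. zmul (int (t choose l)) (zmul (int (fact l) * u l) (e l)))"
    by (intro sum.cong refl) (simp add: falling_coeff_sum algebra_simps)
  also have "\<dots> = (\<Sum>l<k. zmul (int (t choose l)) (e l))"
    using k_less by (intro sum.cong refl, subst u_fact) auto
  finally show ?thesis by simp
qed

lemma expand_binomial:
  assumes "\<And>l. e l \<in> F (s + l)"
  obtains b where "expand s (\<lambda>t. \<Sum>l<k. zmul (int (t choose l)) (e l)) (e 0) b"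
proof -
  let ?c = "\<lambda>j. \<Sum>l\<in>{j..<k}. zmul (u l * falling_coeff l j) (e l)"
  have "?c j \<in> F (s + j)" for j
    by (intro F_sum F_zmul F_mono[OF assms]) auto
  moreover have "?c 0 = e 0"
  proof -
    have "?c 0 = (\<Sum>l\<in>{0}. zmul (u l * falling_coeff l 0) (e l))"
      using k_ge by (intro sum.mono_neutral_right) (auto simp: falling_coeff_zero)
    then show ?thesis by simp
  qed
  ultimately have "expand s (\<lambda>t. \<Sum>l<k. zmul (int (t choose l)) (e l)) (e 0) (?c 1)"
    unfolding expand_def by (intro exI[of _ ?c]) (use binomial_to_power in auto)
  then show ?thesis by (rule that)
qed

end

section \<open>The pre-Lie ring of a filtered brace\<close>

definition difference :: "'a::ab_group_add \<Rightarrow> ('a \<Rightarrow> 'a) \<Rightarrow> 'a \<Rightarrow> 'a" where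
  "difference h f = (\<lambda>x. f (x + h) - f x)"

context primroot_filtration
begin

text \<open>Polynomial maps of weight \<open>s\<close>, tested on \<open>j\<close> successive differences: a difference in a direction
  from \<open>F i\<close> raises the weight by \<open>i\<close>.  Counting the differences is what makes the induction in
  \<open>pol_st\<close> work.\<close>

fun pol :: "nat \<Rightarrow> nat \<Rightarrow> ('a \<Rightarrow> 'a) \<Rightarrow> bool" where
  "pol 0 s f \<longleftrightarrow> (\<forall>x. f x \<in> F s)"
| "pol (Suc j) s f \<longleftrightarrow> (\<forall>x. f x \<in> F s) \<and> (\<forall>i. \<forall>h\<in>F i. pol j (s + i) (difference h f))"

lemma pol_F: "pol j s f \<Longrightarrow> f x \<in> F s"
  by (cases j) auto

lemma pol_Suc_D: "pol (Suc j) s f \<Longrightarrow> pol j s f"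
proof (induction j arbitrary: s f)
  case (Suc j)
  then show ?case by (metis pol.simps(2))
qed simp

lemma pol_mono: "pol j s f \<Longrightarrow> s' \<le> s \<Longrightarrow> pol j s' f"
proof (induction j arbitrary: s s' f)
  case 0
  then show ?case using F_mono by auto
next
  case (Suc j)
  show ?case unfolding pol.simps
  proof (intro conjI allI ballI)
    show "f x \<in> F s'" for x using Suc.prems F_mono by auto
    fix i h assume "h \<in> F i"
    then have "pol j (s + i) (difference h f)" using Suc.prems by auto
    then show "pol j (s' + i) (difference h f)" by (rule Suc.IH) (use Suc.prems in simp)
  qed
qed

lemma pol_shift: "pol j s f \<Longrightarrow> pol j s (\<lambda>x. f (x + h))"
proof (induction j arbitrary: s f)
  case (Suc j)
  have "difference g (\<lambda>x. f (x + h)) = (\<lambda>x. difference g f (x + h))" for g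
    by (auto simp: difference_def algebra_simps)
  then show ?case using Suc by auto
qed simp

lemma pol_add: "pol j s f \<Longrightarrow> pol j s g \<Longrightarrow> pol j s (\<lambda>x. f x + g x)"
proof (induction j arbitrary: s f g)
  case 0
  then show ?case using F_add by auto
next
  case (Suc j)
  have "difference h (\<lambda>x. f x + g x) = (\<lambda>x. difference h f x + difference h g x)" for h
    by (auto simp: difference_def algebra_simps)
  then show ?case using Suc F_add by auto
qed

lemma pol_zmul: "pol j s f \<Longrightarrow> pol j s (\<lambda>x. zmul r (f x))"
proof (induction j arbitrary: s f)
  case 0
  then show ?case using F_zmul by auto
next
  case (Suc j)
  have "difference h (\<lambda>x. zmul r (f x)) = (\<lambda>x. zmul r (difference h f x))" for h
    by (auto simp: difference_def zm.scale_right_diff_distrib)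
  then show ?case using Suc F_zmul by auto
qed

lemma pol_const: "b \<in> F s \<Longrightarrow> pol j s (\<lambda>x. b)"
proof (induction j arbitrary: s b)
  case (Suc j)
  then show ?case using F_zero by (auto simp: difference_def)
qed simp

lemma pol_id: "pol j 0 (\<lambda>x. x)"
  by (cases j) (auto simp: F_0 difference_def intro: pol_const)

lemma pol_sum: "finite S \<Longrightarrow> (\<And>i. i \<in> S \<Longrightarrow> pol j s (f i)) \<Longrightarrow> pol j s (\<lambda>x. \<Sum>i\<in>S. f i x)"
  by (induction S rule: finite_induct) (auto intro: pol_add pol_const[OF F_zero])

definition Pol :: "nat \<Rightarrow> ('a \<Rightarrow> 'a) \<Rightarrow> bool" where
  "Pol s f \<longleftrightarrow> (\<forall>j. pol j s f)"

lemma Pol_difference: "Pol s f \<Longrightarrow> h \<in> F i \<Longrightarrow> Pol (s + i) (difference h f)"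
  unfolding Pol_def by (metis pol.simps(2))

lemma Pol_difference_pow: "Pol s f \<Longrightarrow> h \<in> F i \<Longrightarrow> Pol (s + l * i) ((difference h ^^ l) f)"
proof (induction l)
  case (Suc l)
  then show ?case using Pol_difference[of "s + l * i" "(difference h ^^ l) f" h i] by (simp add: algebra_simps)
qed simp

lemma Pol_F: "Pol s f \<Longrightarrow> f x \<in> F s"
  unfolding Pol_def using pol_F by blast

text \<open>The coefficient of t^e in K(x + t h), obtained by rewriting Newton's forward differences
  in powers of t; see \<open>taylor_expansion\<close>.\<close>

definition taylor :: "('a \<Rightarrow> 'a) \<Rightarrow> 'a \<Rightarrow> nat \<Rightarrow> 'a \<Rightarrow> 'a" where
  "taylor K h e x = (\<Sum>l\<in>{e..<k}. zmul (u l * falling_coeff l e) ((difference h ^^ l) K x))"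

lemma taylor_0: "taylor K h 0 = K"
proof
  fix x
  have "taylor K h 0 x = (\<Sum>l\<in>{0}. zmul (u l * falling_coeff l 0) ((difference h ^^ l) K x))"
    unfolding taylor_def using k_ge by (intro sum.mono_neutral_right) (auto simp: falling_coeff_zero)
  then show "taylor K h 0 x = K x" by simp
qed

lemma Pol_taylor:
  assumes "Pol s K" "h \<in> F i"
  shows "Pol (s + i * e) (taylor K h e)"
  unfolding Pol_def taylor_def
proof (intro allI pol_sum pol_zmul)
  fix j l assume l: "l \<in> {e..<k}"
  have "pol j (s + l * i) ((difference h ^^ l) K)"
    using Pol_difference_pow[OF assms] unfolding Pol_def by blast
  then show "pol j (s + i * e) ((difference h ^^ l) K)"
    by (rule pol_mono) (use l in \<open>simp add: mult.commute\<close>)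
qed simp

text \<open>Newton's series stops before k: as h has positive weight, the k-th difference has weight
  at least k and vanishes.\<close>

lemma newton:
  assumes "Pol s K" "h \<in> F i" "i > 0"
  shows "K (x + zmul (int t) h) = (\<Sum>l<k. zmul (int (t choose l)) ((difference h ^^ l) K x))"
proof (induction t arbitrary: x)
  case 0
  have "(\<Sum>l<k. zmul (int (0 choose l)) ((difference h ^^ l) K x)) = (\<Sum>l\<in>{0}. zmul (int (0 choose l)) ((difference h ^^ l) K x))"
    using k_ge by (intro sum.mono_neutral_right) (auto simp: binomial_eq_0)
  then show ?case by simp
next
  case (Suc t)
  have "s + k * i \<ge> k" using \<open>i > 0\<close> by (metis le_add2 le_trans mult.right_neutral mult_le_mono2 Suc_leI One_nat_def)
  then have top: "(difference h ^^ k) K x = 0"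
    using F_large[OF Pol_F[OF Pol_difference_pow[OF assms(1,2)]]] by blast
  have "K (x + zmul (int (Suc t)) h) = K ((x + h) + zmul (int t) h)"
    by (simp add: zmul_add_left algebra_simps)
  also have "\<dots> = (\<Sum>l<k. zmul (int (t choose l)) ((difference h ^^ l) K x + (difference h ^^ Suc l) K x))"
    by (subst Suc) (simp add: difference_def)
  also have "\<dots> = (\<Sum>l<k. zmul (int (Suc t choose l)) ((difference h ^^ l) K x))"
    by (rule binomial_shift_sum[symmetric]) (rule top)
  finally show ?case .
qed

lemma taylor_expansion:
  assumes "Pol s K" "h \<in> F i" "i > 0"
  shows "K (x + zmul (int t) h) = (\<Sum>e<k. zmul (int t ^ e) (taylor K h e x))"
  unfolding newton[OF assms] binomial_to_power taylor_def ..

text \<open>Adding a term \<open>t ^ j c\<^sub>j\<close> with \<open>j \<ge> 2\<close> to the argument contributes only multiples of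
  \<open>t ^ (j e)\<close>, \<open>e \<ge> 1\<close>, so the linear coefficient depends on \<open>c\<^sub>1\<close> alone.\<close>

lemma expand_compose:
  assumes c: "\<And>j. c j \<in> F j" and "Pol s K"
  shows "expand s (\<lambda>t. K (\<Sum>j\<in>{1..<Suc (Suc J)}. zmul (int t ^ j) (c j))) (K 0) (taylor K (c 1) 1 0)"
  using \<open>Pol s K\<close>
proof (induction J arbitrary: s K)
  case 0
  have "taylor K (c 1) e 0 \<in> F (s + e)" for e
    using Pol_F[OF Pol_taylor[OF 0 c[of 1], of e]] by simp
  moreover have "K (zmul (int t) (c 1)) = (\<Sum>e<k. zmul (int t ^ e) (taylor K (c 1) e 0))" for t
    using taylor_expansion[OF 0 c[of 1], of 0 t] by simp
  ultimately show ?case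
    unfolding expand_def by (intro exI[of _ "\<lambda>e. taylor K (c 1) e 0"]) (simp add: taylor_0)
next
  case (Suc J)
  let ?i = "Suc (Suc J)"
  let ?g = "\<lambda>t. \<Sum>j\<in>{1..<?i}. zmul (int t ^ j) (c j)"
  \<comment> \<open>K is expanded at the shorter path in the direction of the last coefficient, with
    the integer t^?i as parameter. The e-th Taylor coefficient has gained weight ?i e, which
    multiplication by t^(?i e) uses up; for e > 0 nothing of degree 0 or 1 arises.\<close>
  have "expand s (\<lambda>t. zmul (int t ^ (?i * e)) (taylor K (c ?i) e (?g t)))
      (if e = 0 then K 0 else 0) (if e = 0 then taylor K (c 1) 1 0 else 0)" for e
    using expand_shift[OF Suc.IH[OF Pol_taylor[OF Suc.prems c[of ?i], of e]]]
    by (cases "e = 0") (auto simp: taylor_0)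
  then have "expand s (\<lambda>t. \<Sum>e<k. zmul (int t ^ (?i * e)) (taylor K (c ?i) e (?g t)))
      (\<Sum>e<k. if e = 0 then K 0 else 0) (\<Sum>e<k. if e = 0 then taylor K (c 1) 1 0 else 0)"
    by (intro expand_sum) auto
  moreover have "(\<Sum>e<k. zmul (int t ^ (?i * e)) (taylor K (c ?i) e (?g t))) =
      K (\<Sum>j\<in>{1..<Suc ?i}. zmul (int t ^ j) (c j))" for t
  proof -
    have "(\<Sum>j\<in>{1..<Suc ?i}. zmul (int t ^ j) (c j)) = ?g t + zmul (int (t ^ ?i)) (c ?i)"
      by (subst sum.atLeastLessThan_Suc) simp_all
    then show ?thesis
      using taylor_expansion[OF Suc.prems c[of ?i] zero_less_Suc, of "?g t" "t ^ ?i"]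
      by (simp only: power_mult of_nat_power)
  qed
  ultimately show ?case using k_ge by simp
qed

end

text \<open>\<open>st\<close> is the star operation, so a o b = a + b + a * b. With lambda_a(b) = b
  + a * b, the law \<open>st_comp\<close> reads lambda_(a o b) = lambda_a lambda_b.\<close>

locale filtered_brace = primroot_filtration p n k F \<gamma>
  for p n k and F :: "nat \<Rightarrow> 'a::ab_group_add set" and \<gamma> +
  fixes st :: "'a \<Rightarrow> 'a \<Rightarrow> 'a"
  assumes st_add: "st a (b + d) = st a b + st a d"
    and st_comp: "st (a + b + st a b) d = st a (st b d) + st a d + st b d"
    and F_st: "a \<in> F i \<Longrightarrow> b \<in> F j \<Longrightarrow> st a b \<in> F (i + j)"
begin

lemma st_zero_right [simp]: "st a 0 = 0" using st_add[of a 0 0] by simp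
lemma st_diff: "st a (b - d) = st a b - st a d" using st_add[of a "b - d" d] by simp
lemma st_sum: "st a (sum g S) = (\<Sum>i\<in>S. st a (g i))"
  using additive_sum[of "st a"] st_add by blast
lemma st_zmul: "st a (zmul r x) = zmul r (st a x)"
  using additive_zmul[of "st a"] st_add by blast

lemma F_st1: "b \<in> F j \<Longrightarrow> st a b \<in> F (Suc j)"
  using F_st[of a "Suc 0"] F_1 by simp

lemma st_zero_left [simp]: "st 0 d = 0"
proof (rule F_converge)
  show "st 0 d \<in> F 0" by (simp add: F_0)
  fix i assume i: "st 0 d \<in> F i"
  \<comment> \<open>If z = 0 * 0 is zero, lambda_0 is idempotent; as \<open>st 0\<close> raises the
    weight, the identity pushes \<open>st 0 d\<close> one level deeper.\<close>
  have "st 0 (st 0 d) = - st 0 d" using st_comp[of 0 0 d] by (simp add: algebra_simps eq_neg_iff_add_eq_0)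
  then show "st 0 d \<in> F (Suc i)" using F_st1[OF i, of 0] F_uminus by fastforce
qed

lemma st_pow_F: "b \<in> F j \<Longrightarrow> (st a ^^ i) b \<in> F (i + j)"
  by (induction i) (auto intro: F_st1)

lemma st_pow_vanish: "k \<le> Suc i \<Longrightarrow> (st a ^^ i) b = 0"
  using F_large[OF st_pow_F[of b "Suc 0" i a]] F_1 by simp

text \<open>The Neumann series for the inverse of lambda_a, finite because \<open>st a\<close>
  raises the weight.\<close>

definition lam_inv :: "'a \<Rightarrow> 'a \<Rightarrow> 'a" where
  "lam_inv a b = (\<Sum>i<k. zmul ((- 1) ^ i) ((st a ^^ i) b))"

lemma lam_inv: "lam_inv a b + st a (lam_inv a b) = b"
proof -
  let ?T = "\<lambda>i. zmul ((- 1) ^ i) ((st a ^^ i) b)"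
  have "lam_inv a b + st a (lam_inv a b) = - (\<Sum>i<k. ?T (Suc i) - ?T i)"
    unfolding lam_inv_def st_sum st_zmul
    by (simp add: sum_subtractf sum_negf)
  also have "\<dots> = - (?T k - ?T 0)" by (rule arg_cong[OF sum_lessThan_telescope[of ?T]])
  also have "\<dots> = b" by (simp add: st_pow_vanish)
  finally show ?thesis .
qed

lemma st_pow_zmul: "(st a ^^ i) (zmul r b) = zmul r ((st a ^^ i) b)"
  by (induction i) (auto simp: st_zmul)

lemma lam_inv_zmul: "lam_inv a (zmul r b) = zmul r (lam_inv a b)"
  by (simp add: lam_inv_def st_pow_zmul zm.scale_sum_right mult.commute)

text \<open>Since a + b = a o lambda_a^(-1)(b), the law \<open>st_comp\<close> measures how far the
  star operation is from being additive on the left.\<close>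

lemma st_add_left: "st (a + b) d = st a d + (st (lam_inv a b) d + st a (st (lam_inv a b) d))"
proof -
  have "a + b = a + lam_inv a b + st a (lam_inv a b)" using lam_inv[of a b] by (simp add: add.assoc)
  then show ?thesis using st_comp[of a "lam_inv a b" d] by (simp add: algebra_simps)
qed

text \<open>Writing f(x + h) = f(x) o b(x), with b(x) the inverse of lambda_(f x) applied to the
  difference of f, splits the difference of f * g into star products that each contain b or a
  difference of g.\<close>

lemma pol_st: "pol j s f \<Longrightarrow> pol j r g \<Longrightarrow> pol j (s + r) (\<lambda>x. st (f x) (g x))"
proof (induction j arbitrary: s r f g)
  case 0
  then show ?case using F_st by auto
next
  case (Suc j)
  show ?case unfolding pol.simps
  proof (intro conjI allI ballI)
    show "st (f x) (g x) \<in> F (s + r)" for x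
      using F_st Suc.prems pol_F by blast
    fix i h assume h: "h \<in> F i"
    let ?b = "\<lambda>x. lam_inv (f x) (difference h f x)"
    have f: "pol j s f" and g: "pol j r g" using Suc.prems pol_Suc_D by blast+
    have df: "pol j (s + i) (difference h f)" and dg: "pol j (r + i) (difference h g)"
      using Suc.prems h by auto
    \<comment> \<open>The map b is itself a sum of iterated star products, so the hypothesis for j
      applies to it as well as to the terms of the splitting.\<close>
    have "pol j (s + i) (\<lambda>x. (st (f x) ^^ l) (difference h f x))" for l
    proof (induction l)
      case (Suc l)
      from Suc.IH \<open>pol j s f\<close> have "pol j (s + (s + i)) (\<lambda>x. st (f x) ((st (f x) ^^ l) (difference h f x)))"
        using \<open>\<And>s r f g. pol j s f \<Longrightarrow> pol j r g \<Longrightarrow> pol j (s + r) (\<lambda>x. st (f x) (g x))\<close> by blast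
      then show ?case using pol_mono by fastforce
    qed (use df in simp)
    then have b: "pol j (s + i) ?b"
      unfolding lam_inv_def by (intro pol_sum pol_zmul) auto
    have bg: "pol j (s + i + r) (\<lambda>x. st (?b x) (g x))" using Suc.IH[OF b g] .
    have "pol j (s + (s + i + r)) (\<lambda>x. st (f x) (st (?b x) (g x)))" using Suc.IH[OF f bg] .
    then have fbg: "pol j (s + i + r) (\<lambda>x. st (f x) (st (?b x) (g x)))" by (rule pol_mono) simp
    have fg: "pol j (s + i + r) (\<lambda>x. st (f (x + h)) (difference h g x))"
      by (rule pol_mono[OF Suc.IH[OF pol_shift[OF f] dg]]) simp
    have "difference h (\<lambda>x. st (f x) (g x)) =
        (\<lambda>x. st (f (x + h)) (difference h g x) + (st (?b x) (g x) + st (f x) (st (?b x) (g x))))"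
    proof
      fix x
      have "f (x + h) = f x + difference h f x" by (simp add: difference_def)
      from st_add_left[of "f x" "difference h f x" "g x"]
      have "st (f (x + h)) (g x) - st (f x) (g x) = st (?b x) (g x) + st (f x) (st (?b x) (g x))"
        by (simp add: \<open>f (x + h) = f x + difference h f x\<close>)
      moreover have "st (f (x + h)) (difference h g x) = st (f (x + h)) (g (x + h)) - st (f (x + h)) (g x)"
        by (simp add: difference_def st_diff)
      ultimately show "difference h (\<lambda>x. st (f x) (g x)) x =
          st (f (x + h)) (difference h g x) + (st (?b x) (g x) + st (f x) (st (?b x) (g x)))"
        by (simp add: difference_def algebra_simps)
    qed
    moreover have "pol j (s + i + r) (\<lambda>x. st (f (x + h)) (difference h g x) + (st (?b x) (g x) + st (f x) (st (?b x) (g x))))"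
      by (intro pol_add fg bg fbg)
    ultimately show "pol j (s + r + i) (difference h (\<lambda>x. st (f x) (g x)))"
      by (metis pol_mono add.assoc add.commute order_refl)
  qed
qed

lemma Pol_st:
  assumes "b \<in> F s"
  shows "Pol s (\<lambda>x. st x b)"
  unfolding Pol_def using pol_st[OF pol_id pol_const[OF assms]] by simp

text \<open>The associated pre-Lie product, by \<open>assoc_prelie_eq_dot\<close>, read as a linear
  coefficient in t.\<close>

definition dot :: "'a \<Rightarrow> 'a \<Rightarrow> 'a" where
  "dot a b = coef 1 (\<lambda>t. st (zmul (int t) a) b)"

lemma expand_st_const:
  assumes "expand 0 f 0 f1" "b \<in> F s"
  shows "expand s (\<lambda>t. st (f t) b) 0 (dot f1 b)"
proof -
  note comp = expand_compose[OF _ Pol_st[OF assms(2)]]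
  obtain c where c: "\<And>j. c j \<in> F j" "\<And>t. f t = (\<Sum>j<k. zmul (int t ^ j) (c j))" "c 0 = 0" "c 1 = f1"
    using assms(1) unfolding expand_def by auto
  have "f t = (\<Sum>j\<in>{1..<Suc (Suc (k - 2))}. zmul (int t ^ j) (c j))" for t
  proof -
    have "{..<k} = insert 0 {1..<Suc (Suc (k - 2))}" using k_ge by auto
    then show ?thesis by (simp add: c)
  qed
  then have *: "expand s (\<lambda>t. st (f t) b) 0 (taylor (\<lambda>x. st x b) f1 1 0)"
    using comp[of c "k - 2"] c by simp
  \<comment> \<open>The straight path t f1 has the same linear coefficient as f, and
    \<open>expand_compose\<close> sees nothing else; this identifies the result with
    \<open>dot f1 b\<close>.\<close>
  define d where "d j = (if j = 1 then f1 else 0)" for j :: nat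
  have "expand s (\<lambda>t. st (zmul (int t) f1) b) 0 (taylor (\<lambda>x. st x b) f1 1 0)"
    using comp[of d 0] F_1 F_zero by (simp add: d_def)
  then have "dot f1 b = taylor (\<lambda>x. st x b) f1 1 0"
    unfolding dot_def by (rule expand_coef)
  with * show ?thesis by simp
qed

text \<open>As f(0) = 0, only the constant coefficient of \<open>\<phi>\<close> reaches the linear
  coefficient of the product.\<close>

lemma expand_st:
  assumes f: "expand 0 f 0 f1" and "expand s \<phi> a b"
  shows "expand s (\<lambda>t. st (f t) (\<phi> t)) 0 (dot f1 a)"
proof -
  obtain c where c: "\<And>j. c j \<in> F (s + j)" "\<And>t. \<phi> t = (\<Sum>j<k. zmul (int t ^ j) (c j))" "c 0 = a" "c 1 = b"
    using assms(2) unfolding expand_def by blast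
  have "expand s (\<lambda>t. zmul (int t ^ j) (st (f t) (c j))) 0 (if j = 0 then dot f1 a else 0)" for j
    using expand_shift[OF expand_st_const[OF f c(1)[of j]]] c by (cases "j = 0") auto
  then have "expand s (\<lambda>t. \<Sum>j<k. zmul (int t ^ j) (st (f t) (c j))) (\<Sum>j<k. 0) (\<Sum>j<k. if j = 0 then dot f1 a else 0)"
    by (intro expand_sum) auto
  then show ?thesis using k_ge by (simp add: c st_sum st_zmul)
qed

lemma dot_add_right: "dot x (y + z) = dot x y + dot x z"
  by (simp add: dot_def st_add coef_add)

lemma dot_add_left: "dot (a + c) b = dot a b + dot c b"
proof -
  let ?a = "\<lambda>t. zmul (int t) a" and ?c = "\<lambda>t. zmul (int t) c"
  have b: "expand 1 (\<lambda>t. b) b 0" and c: "expand 1 (\<lambda>t. c) c 0"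
    using expand_const[of _ 1] F_1 by auto
  \<comment> \<open>(t a) * (t c) = t ((t a) * c) is of second order, so the path (t a) o (t c) has
    linear coefficient a + c.\<close>
  have ac: "expand 1 (\<lambda>t. st (?a t) c) 0 (dot a c)"
    by (rule expand_st[OF expand_linear c])
  have "expand 0 (\<lambda>t. ?a t + ?c t + st (?a t) (?c t)) 0 (a + c)"
    using expand_add[OF expand_add[OF expand_linear expand_linear] expand_shift[of 0 1, simplified, OF ac[simplified]]]
    by (simp add: st_zmul)
  from expand_st[OF this b]
  have 1: "expand 1 (\<lambda>t. st (?a t + ?c t + st (?a t) (?c t)) b) 0 (dot (a + c) b)" .
  have cb: "expand 1 (\<lambda>t. st (?c t) b) 0 (dot c b)" "expand 1 (\<lambda>t. st (?a t) b) 0 (dot a b)"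
    by (rule expand_st[OF expand_linear b])+
  have 2: "expand 1 (\<lambda>t. st (?a t) (st (?c t) b) + st (?a t) b + st (?c t) b) 0 (dot a b + dot c b)"
    using expand_add[OF expand_add[OF expand_st[OF expand_linear cb(1)] cb(2)] cb(1), of a] by (simp add: dot_def coef_zero)
  show ?thesis
    using expand_coef[OF 1] expand_coef[OF 2] unfolding st_comp by simp
qed

lemma F_dot: "a \<in> F i \<Longrightarrow> b \<in> F j \<Longrightarrow> dot a b \<in> F (i + j)"
  unfolding dot_def coef_def by (intro F_zmul F_sum F_st)

sublocale dot: filtered_algebra p n k F dot
  by unfold_locales (fact dot_add_left dot_add_right F_dot)+

text \<open>The associator is the mixed second derivative of \<open>(s x + t y) * d\<close>, which is symmetric.\<close>

lemma dot_associator: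
  "coef 1 (\<lambda>s. coef 1 (\<lambda>t. st (zmul (int s) x + zmul (int t) y) d)) = dot x (dot y d) - dot (dot x y) d"
proof -
  \<comment> \<open>s x + t y = (s x) o (t y(s)) with y(s) the inverse of lambda_(s x) applied to y.
    Hence the inner derivative in t is lambda_(s x) applied to \<open>dot (?y s) d\<close>.\<close>
  let ?y = "\<lambda>s. lam_inv (zmul (int s) x) y"
  have "coef 1 (\<lambda>t. st (zmul (int s) x + zmul (int t) y) d) = dot (?y s) d + st (zmul (int s) x) (dot (?y s) d)" for s
  proof -
    have "coef 1 (\<lambda>t. st (zmul (int s) x) d) = 0"
      using expand_coef[OF expand_const[of _ 0]] F_0 by simp
    then show ?thesis
      by (simp add: st_add_left lam_inv_zmul coef_add coef_additive[of "st _", OF st_add] dot_def)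
  qed
  \<comment> \<open>Up to first order in s the Neumann series is y - s \<open>dot x y\<close>; only
    i = 0 and i = 1 contribute.\<close>
  moreover have y: "expand 1 ?y y (- dot x y)"
  proof -
    have T: "expand 1 (\<lambda>s. zmul ((- 1) ^ i) ((st (zmul (int s) x) ^^ i) y))
        (if i = 0 then y else 0) (if i = 1 then - dot x y else 0)" for i
    proof -
      have "expand 1 (\<lambda>s. (st (zmul (int s) x) ^^ i) y) (if i = 0 then y else 0) (if i = 1 then dot x y else 0)"
      proof (induction i)
        case 0
        then show ?case using expand_const[of y 1] F_1 by simp
      next
        case (Suc i)
        then show ?case using expand_st[OF expand_linear Suc, of x] by auto
      qed
      from expand_additive[of "zmul ((- 1) ^ i)" 1 1, OF zmul_add_right F_zmul this]
      show ?thesis by (cases "i = 0 \<or> i = 1") auto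
    qed
    have "expand 1 ?y (\<Sum>i<k. if i = 0 then y else 0) (\<Sum>i<k. if i = 1 then - dot x y else 0)"
      unfolding lam_inv_def by (intro expand_sum T) auto
    then show ?thesis using k_ge by simp
  qed
  have "expand 1 (\<lambda>s. dot (?y s) d) (dot y d) (- dot (dot x y) d)"
    using expand_additive[of "\<lambda>x. dot x d" 1 1, OF dot_add_left _ y] F_dot[of _ _ d 0] F_0 dot.diff_left[of 0 "dot x y" d]
    by simp
  from expand_add[OF this expand_st[OF expand_linear this, of x]]
  have "expand 1 (\<lambda>s. dot (?y s) d + st (zmul (int s) x) (dot (?y s) d)) (dot y d) (- dot (dot x y) d + dot x (dot y d))"
    by simp
  ultimately show ?thesis using expand_coef by fastforce
qed

lemma dot_prelie: "dot (dot x y) z - dot x (dot y z) = dot (dot y x) z - dot y (dot x z)"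
proof -
  have "coef 1 (\<lambda>s. coef 1 (\<lambda>t. st (zmul (int s) x + zmul (int t) y) z)) =
      coef 1 (\<lambda>s. coef 1 (\<lambda>t. st (zmul (int s) y + zmul (int t) x) z))"
    by (subst coef_swap) (simp add: add.commute)
  then show ?thesis unfolding dot_associator by (simp add: algebra_simps)
qed

end

section \<open>Logarithms in the circle group\<close>

context filtered_brace
begin

text \<open>Coefficient comparison in f' = v + \<open>dot x f\<close>; c k = 0 lets f' be written
  with k terms. In \<open>circle_log\<close> it is used with v = x for the circle powers and with v
  = 0 for lambda.\<close>

lemma poly_ode:
  assumes "c k = 0"
    and ode: "\<And>t. coef 1 (\<lambda>s. \<Sum>j<k. zmul (int (s + t) ^ j) (c j)) =
      v + dot x (\<Sum>j<k. zmul (int t ^ j) (c j))"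
    and "e < k"
  shows "zmul (int (Suc e)) (c (Suc e)) = (if e = 0 then v else 0) + dot x (c e)"
proof -
  have *: "(\<Sum>j<k. zmul (int t ^ j) (zmul (int (Suc j)) (c (Suc j)))) =
      (\<Sum>j<k. zmul (int t ^ j) ((if j = 0 then v else 0) + dot x (c j)))" for t
  proof -
    have "(\<Sum>j<k. zmul (int t ^ j) (zmul (int (Suc j)) (c (Suc j)))) =
        (\<Sum>j<Suc k. zmul (int j * int t ^ (j - 1)) (c j))"
      by (subst sum.lessThan_Suc_shift) (simp add: mult.commute)
    also have "\<dots> = v + dot x (\<Sum>j<k. zmul (int t ^ j) (c j))"
      using ode[of t] assms(1) unfolding coef_translate by simp
    also have "v = (\<Sum>j<k. zmul (int t ^ j) (if j = 0 then v else 0))"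
      using k_ge by (simp add: if_distrib[of "zmul _"] cong: if_cong)
    finally show ?thesis
      by (simp add: dot.sum_right dot.zmul_right zm.scale_right_distrib sum.distrib)
  qed
  have "coef e (\<lambda>t. \<Sum>j<k. zmul (int t ^ j) (zmul (int (Suc j)) (c (Suc j)))) =
      coef e (\<lambda>t. \<Sum>j<k. zmul (int t ^ j) ((if j = 0 then v else 0) + dot x (c j)))"
    by (simp only: *)
  then show ?thesis unfolding coef_poly[OF \<open>e < k\<close>] .
qed

text \<open>The powers \<open>x(t)\<close> of \<open>a\<close> in the circle group are polynomial in \<open>t\<close>; differentiating
  \<open>x(s + t) = x(s) \<circ> x(t)\<close> at \<open>s = 0\<close> identifies them with the flow of the linear coefficient.\<close>

lemma circle_log:
  obtains x where "dot.W x = a" "\<And>b. dot.E x b = b + st a b"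
proof -
  define xs where "xs t = ((\<lambda>y. a + y + st a y) ^^ t) 0" for t
  have xs_0: "xs 0 = 0" and xs_Suc: "xs (Suc t) = a + xs t + st a (xs t)" for t
    by (simp_all add: xs_def)
  \<comment> \<open>xs t is the sum of lambda_a^i(a) over i < t, and lambda_a is the identity plus
    \<open>st a\<close>; so the Newton coefficients of xs are the iterates of \<open>st a\<close> at
    a.\<close>
  define e where "e l = (if l = 0 then 0 else (st a ^^ (l - 1)) a)" for l
  have e_F: "e l \<in> F (0 + l)" for l
    using st_pow_F[of a "Suc 0" "l - 1" a] F_1 by (auto simp: e_def F_zero)
  have e_Suc: "e (Suc l) = st a (e l) + (if l = 0 then a else 0)" for l
    by (cases l) (simp_all add: e_def)
  have xs_sum: "xs t = (\<Sum>l<k. zmul (int (t choose l)) (e l))" for t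
  proof (induction t)
    case 0
    have "zmul (int (0 choose l)) (e l) = 0" for l by (cases l) (simp_all add: e_def)
    then show ?case by (simp add: xs_0)
  next
    case (Suc t)
    have "(\<Sum>l<k. zmul (int (Suc t choose l)) (e l)) = (\<Sum>l<k. zmul (int (t choose l)) (e l + e (Suc l)))"
      by (rule binomial_shift_sum) (use k_ge in \<open>simp add: e_def st_pow_vanish\<close>)
    also have "\<dots> = xs t + st a (xs t) + (\<Sum>l<k. zmul (int (t choose l)) (if l = 0 then a else 0))"
      unfolding e_Suc Suc by (simp add: zm.scale_right_distrib sum.distrib st_sum st_zmul)
    also have "(\<Sum>l<k. zmul (int (t choose l)) (if l = 0 then a else 0)) = a"
      using k_ge by (simp add: if_distrib[of "zmul _"] cong: if_cong)
    finally show ?case by (simp add: xs_Suc algebra_simps)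
  qed
  obtain x where x: "expand 0 xs 0 x"
    using expand_binomial[of e 0, OF e_F] unfolding xs_sum[symmetric] by (auto simp: e_def)
  then obtain c where c: "\<And>j. c j \<in> F j" "\<And>t. xs t = (\<Sum>j<k. zmul (int t ^ j) (c j))" "c 0 = 0" "c 1 = x"
    unfolding expand_def by auto
  have xs_add: "xs (s + t) = xs s + xs t + st (xs s) (xs t)" for s t
  proof (induction s)
    case 0
    then show ?case by (simp add: xs_0)
  next
    case (Suc s)
    have "xs (Suc s + t) = a + xs (s + t) + st a (xs (s + t))" by (simp add: xs_Suc)
    then show ?case
      unfolding Suc using st_comp[of a "xs s" "xs t"] by (simp add: xs_Suc st_add algebra_simps)
  qed
  have ck: "c k = 0" using F_k c(1) by blast
  have const: "coef 1 (\<lambda>s. z) = 0" for z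
    using expand_coef[OF expand_const[of z 0]] F_0 by simp
  have lin: "coef 1 (\<lambda>s. st (xs s) z) = dot x z" for z
    using expand_coef[OF expand_st_const[OF x, of z 0]] F_0 by simp
  have "coef 1 (\<lambda>s. \<Sum>j<k. zmul (int (s + t) ^ j) (c j)) = x + dot x (\<Sum>j<k. zmul (int t ^ j) (c j))" for t
    unfolding c(2)[symmetric] xs_add by (simp only: coef_add const lin expand_coef[OF x] add_0_right)
  then have c_ode: "zmul (int (Suc e)) (c (Suc e)) = (if e = 0 then x else 0) + dot x (c e)" if "e < k" for e
    by (rule poly_ode[where c = c, OF ck _ that])
  have c_eq: "c (Suc j) = zmul (u (Suc j)) ((dot x ^^ j) x)" if "j < k" for j
    using that
  proof (induction j)
    case 0
    then show ?case using c by simp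
  next
    case (Suc j)
    have *: "Suc (Suc j) < p" using Suc.prems k_less by simp
    have "zmul (int (Suc (Suc j))) (c (Suc (Suc j))) = dot x (c (Suc j))"
      using c_ode[of "Suc j"] Suc.prems by simp
    also have "\<dots> = zmul (u (Suc j)) ((dot x ^^ Suc j) x)"
      using Suc by (simp add: dot.zmul_right)
    also have "\<dots> = zmul (int (Suc (Suc j))) (zmul (u (Suc (Suc j))) ((dot x ^^ Suc j) x))"
      by (rule u_Suc[OF *, symmetric])
    finally show ?case by (rule nat_cancel[OF zero_less_Suc *])
  qed
  have one: "(\<Sum>j<k. zmul (int 1 ^ j) (f j)) = sum f {..<k}" for f :: "nat \<Rightarrow> 'a"
    by simp
  have "a = xs 1" by (simp add: xs_Suc xs_0)
  \<comment> \<open>As c k = 0 the range may be extended to k; removing c 0 = 0 then leaves exactly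
    the k terms of \<open>dot.W x\<close>.\<close>
  also have "\<dots> = (\<Sum>j<Suc k. c j)" unfolding c(2) one by (simp add: ck)
  also have "\<dots> = dot.W x"
    unfolding dot.W_def by (subst sum.lessThan_Suc_shift) (simp add: c c_eq)
  finally have "dot.W x = a" by simp
  moreover have "dot.E x b = b + st a b" for b
  proof -
    \<comment> \<open>The path lambda_(xs t)(b), a flow with initial value b, which solves the
      homogeneous equation.\<close>
    let ?y = "\<lambda>t. b + st (xs t) b"
    have b1: "b \<in> F 1" using F_1 by simp
    obtain d where d: "\<And>j. d j \<in> F (1 + j)" "\<And>t. ?y t = (\<Sum>j<k. zmul (int t ^ j) (d j))" "d 0 = b"
      using expand_add[OF expand_const[OF b1] expand_st_const[OF x b1]] unfolding expand_def by auto
    have dk: "d k = 0" using F_large[OF d(1)[of k]] by simp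
    have y_add: "?y (s + t) = ?y t + st (xs s) (?y t)" for s t
      using st_comp[of "xs s" "xs t" b] by (simp add: xs_add st_add algebra_simps)
    have "coef 1 (\<lambda>s. \<Sum>j<k. zmul (int (s + t) ^ j) (d j)) = 0 + dot x (\<Sum>j<k. zmul (int t ^ j) (d j))" for t
      unfolding d(2)[symmetric] y_add by (simp only: coef_add const lin add_0_left)
    then have d_ode: "zmul (int (Suc e)) (d (Suc e)) = (if e = 0 then 0 else 0) + dot x (d e)" if "e < k" for e
      by (rule poly_ode[where c = d, OF dk _ that])
    have d_eq: "d j = zmul (u j) ((dot x ^^ j) b)" if "j < k" for j
      using that
    proof (induction j)
      case 0
      then show ?case using d by simp
    next
      case (Suc j)
      have *: "Suc j < p" using Suc.prems k_less by simp
      have "zmul (int (Suc j)) (d (Suc j)) = dot x (d j)"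
        using d_ode[of j] Suc.prems by simp
      also have "\<dots> = zmul (u j) ((dot x ^^ Suc j) b)"
        using Suc by (simp add: dot.zmul_right)
      also have "\<dots> = zmul (int (Suc j)) (zmul (u (Suc j)) ((dot x ^^ Suc j) b))"
        by (rule u_Suc[OF *, symmetric])
      finally show ?case by (rule nat_cancel[OF zero_less_Suc *])
    qed
    have "b + st a b = ?y 1" using \<open>a = xs 1\<close> by simp
    also have "\<dots> = sum d {..<k}" unfolding d(2) one ..
    also have "\<dots> = dot.E x b" unfolding dot.E_def by (rule sum.cong) (use d_eq in auto)
    finally show ?thesis by simp
  qed
  ultimately show ?thesis by (rule that)
qed

end

section \<open>The strong series and finiteness\<close>

declare strong_series.simps [simp del]

lemma strong_series_le_1: "i \<le> 1 \<Longrightarrow> strong_series op i = UNIV"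
  by (subst strong_series.simps) simp

lemma addgen_least:
  assumes "S \<subseteq> H" "0 \<in> H" "\<And>a b. a \<in> H \<Longrightarrow> b \<in> H \<Longrightarrow> a - b \<in> H"
  shows "addgen S \<subseteq> H"
proof
  fix x assume "x \<in> addgen S"
  then show "x \<in> H" by induction (use assms in auto)
qed

lemma strong_series_zero: "0 \<in> strong_series op i"
  by (subst strong_series.simps) (simp add: subsum_def addgen.zero)

lemma strong_series_diff: "a \<in> strong_series op i \<Longrightarrow> b \<in> strong_series op i \<Longrightarrow> a - b \<in> strong_series op i"
  by (subst strong_series.simps, subst (asm) (1 2) strong_series.simps)
    (auto simp: subsum_def intro: addgen.diff split: if_splits)

lemma strong_series_mult_pos:
  assumes "x \<in> strong_series op i" "y \<in> strong_series op j" "1 \<le> i" "1 \<le> j"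
  shows "op x y \<in> strong_series op (i + j)"
proof -
  have "op x y \<in> subprod op (strong_series op i) (strong_series op (i + j - i))"
    unfolding subprod_def using assms by (auto intro!: addgen.base)
  then have "op x y \<in> subsum {1..i + j - 1} (\<lambda>l. subprod op (strong_series op l) (strong_series op (i + j - l)))"
    unfolding subsum_def using assms by (intro addgen.base UN_I[of i]) auto
  then show ?thesis using assms by (subst strong_series.simps) auto
qed

lemma strong_series_least:
  assumes "0 \<in> H" "\<And>a b. a \<in> H \<Longrightarrow> b \<in> H \<Longrightarrow> a - b \<in> H" "2 \<le> i"
    and "\<And>x y j. x \<in> strong_series op j \<Longrightarrow> y \<in> strong_series op (i - j) \<Longrightarrow> 1 \<le> j \<Longrightarrow> j < i \<Longrightarrow> op x y \<in> H"
  shows "strong_series op i \<subseteq> H"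
proof -
  have "strong_series op i = subsum {1..i - 1} (\<lambda>j. subprod op (strong_series op j) (strong_series op (i - j)))"
    using assms(3) by (subst strong_series.simps) simp
  also have "\<dots> \<subseteq> H"
    unfolding subsum_def subprod_def
    by (intro addgen_least UN_least) (use assms in \<open>auto\<close>)
  finally show ?thesis .
qed

text \<open>In a generator of A^[i+1] one factor can be lowered by one index using the induction
  hypothesis: the right factor if the left one has index 1, otherwise the left one.\<close>

lemma strong_series_Suc: "strong_series op (Suc i) \<subseteq> strong_series op i"
proof (induction i rule: less_induct)
  case (less i)
  show ?case
  proof (cases "i \<le> 1")
    case True
    then show ?thesis by (simp add: strong_series_le_1)
  next
    case False
    show ?thesis
    proof (rule strong_series_least)
      fix x y j
      assume x: "x \<in> strong_series op j" and y: "y \<in> strong_series op (Suc i - j)" and j: "1 \<le> j" "j < Suc i"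
      show "op x y \<in> strong_series op i"
      proof (cases "j = 1")
        case True
        have "strong_series op (Suc (i - 1)) \<subseteq> strong_series op (i - 1)" using False by (intro less) simp
        then have "y \<in> strong_series op (i - 1)" using y True False by auto
        from strong_series_mult_pos[OF x this] show ?thesis using True False by simp
      next
        case False
        then have "strong_series op (Suc (j - 1)) \<subseteq> strong_series op (j - 1)" using j by (intro less) simp
        then have "x \<in> strong_series op (j - 1)" using x j by auto
        from strong_series_mult_pos[OF this y] show ?thesis using False j by simp
      qed
    qed (use False in \<open>auto intro: strong_series_zero strong_series_diff\<close>)
  qed
qed

lemma strong_series_mult:
  assumes "x \<in> strong_series op i" "y \<in> strong_series op j"
  shows "op x y \<in> strong_series op (i + j)"
proof -
  \<comment> \<open>Index 0 is a duplicate of index 1, so it is first raised to 1, where the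
    recursion for the series applies.\<close>
  have max: "z \<in> strong_series op (max 1 i)" if "z \<in> strong_series op i" for z i
    using that by (cases "i = 0") (auto simp: strong_series_le_1 max_def)
  have "op x y \<in> strong_series op (max 1 i + max 1 j)"
    by (intro strong_series_mult_pos max assms) auto
  moreover have "strong_series op (max 1 i + max 1 j) \<subseteq> strong_series op (i + j)"
    by (rule lift_Suc_antimono_le[of "strong_series op"]) (auto intro: subsetD[OF strong_series_Suc])
  ultimately show ?thesis by blast
qed

text \<open>Minimality of the strong series among multiplicative filtrations. Applied in both
  directions, it yields equality of the series of a brace and of its pre-Lie ring.\<close>

lemma strong_series_subset:
  assumes "\<And>i. 0 \<in> F i" "\<And>i a b. a \<in> F i \<Longrightarrow> b \<in> F i \<Longrightarrow> a - b \<in> F i" "F 0 = UNIV" "F 1 = UNIV"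
    and "\<And>x y i j. x \<in> F i \<Longrightarrow> y \<in> F j \<Longrightarrow> op x y \<in> F (i + j)"
  shows "strong_series op i \<subseteq> F i"
proof (induction i rule: less_induct)
  case (less i)
  show ?case
  proof (cases "i \<le> 1")
    case True
    then have "i = 0 \<or> i = 1" by auto
    then show ?thesis using assms by auto
  next
    case False
    show ?thesis
    proof (rule strong_series_least)
      fix x y j
      assume "x \<in> strong_series op j" "y \<in> strong_series op (i - j)" "1 \<le> j" "j < i"
      then have "x \<in> F j" "y \<in> F (i - j)" using less[of j] less[of "i - j"] by auto
      from assms(5)[OF this] show "op x y \<in> F i" using \<open>j < i\<close> by simp
    qed (use assms False in auto)
  qed
qed

section \<open>Finite abelian groups and nilpotent endomorphisms\<close>

lemma zmul_card_eq_zero: "zmul (int (card (UNIV :: 'a set))) (x :: 'a::{ab_group_add, finite}) = 0"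
proof -
  \<comment> \<open>The sum of all elements of the group is invariant under translation by
    x.\<close>
  have "(\<Sum>y\<in>UNIV. y + x) = (\<Sum>y\<in>UNIV. y)"
    by (rule sum.reindex_bij_witness[of _ "\<lambda>y. y - x" "\<lambda>y. y + x"]) auto
  then have "(\<Sum>y\<in>(UNIV::'a set). x) = 0" by (simp add: sum.distrib)
  moreover have "(\<Sum>y\<in>S. x) = zmul (int (card S)) x" if "finite S" for S :: "'a set"
    using that by (induction S rule: finite_induct) (simp_all add: zmul_add_left)
  ultimately show ?thesis by simp
qed

lemma card_additive_subgroup_dvd:
  fixes H :: "'a::{ab_group_add, finite} set"
  assumes "0 \<in> H" "\<And>a b. a \<in> H \<Longrightarrow> b \<in> H \<Longrightarrow> a - b \<in> H"
  shows "card H dvd card (UNIV :: 'a set)"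
proof -
  let ?G = "\<lparr>carrier = UNIV :: 'a set, monoid.mult = (+), one = 0\<rparr>"
  interpret group ?G
    by (rule groupI) (auto simp: add.assoc intro: exI[of _ "- _"])
  have inv: "inv\<^bsub>?G\<^esub> x = - x" for x by (rule inv_equality) auto
  have neg: "- a \<in> H" if "a \<in> H" for a using assms(2)[OF assms(1) that] by simp
  have "subgroup H ?G"
    by unfold_locales (use assms neg assms(2)[OF _ neg] inv in auto)
  then have "card (rcosets\<^bsub>?G\<^esub> H) * card H = order ?G" by (intro lagrange) auto
  then show ?thesis unfolding order_def by (metis dvd_triv_right partial_object.select_convs(1))
qed

text \<open>The kernels of the powers of f grow strictly until they fill the group, and by Lagrange
  each strict step multiplies the order by at least p. This justifies the cut-off at n in
  \<open>expL\<close>, as the filtration only gives vanishing in terms of k.\<close>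

lemma nilpotent_endo_pow:
  fixes f :: "'a::{ab_group_add, finite} \<Rightarrow> 'a"
  assumes p: "prime p" and card: "card (UNIV :: 'a set) = p ^ n"
    and add: "\<And>x y. f (x + y) = f x + f y" and nil: "\<And>x. (f ^^ M) x = 0"
  shows "(f ^^ n) x = 0"
proof -
  define K where "K j = {x. (f ^^ j) x = 0}" for j
  have f0: "f 0 = 0" using add[of 0 0] by simp
  have pow_add: "(f ^^ j) (x + y) = (f ^^ j) x + (f ^^ j) y" for j x y
    by (induction j) (auto simp: add)
  have pow_diff: "(f ^^ j) (x - y) = (f ^^ j) x - (f ^^ j) y" for j x y
    using pow_add[of j "x - y" y] by (simp add: algebra_simps)
  have dvd: "card (K j) dvd p ^ n" for j
    unfolding card[symmetric] by (rule card_additive_subgroup_dvd) (use pow_diff[of j 0 0] in \<open>auto simp: K_def pow_diff\<close>)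
  have sub: "K j \<subseteq> K (Suc j)" for j by (auto simp: K_def f0)
  have stab: "K j = UNIV" if "K j = K (Suc j)" for j
  proof -
    have "K (j + i) = K j" for i
    proof (induction i)
      case (Suc i)
      have "x \<in> K (j + Suc i) \<longleftrightarrow> f x \<in> K (j + i)" for x by (simp add: K_def funpow_swap1)
      moreover have "x \<in> K (Suc j) \<longleftrightarrow> f x \<in> K j" for x by (simp add: K_def funpow_swap1)
      ultimately show ?case using Suc that by blast
    qed simp
    from this[of M] have "K j = K (M + j)" by (simp add: add.commute)
    also have "\<dots> = UNIV"
    proof -
      have "(f ^^ i) 0 = 0" for i by (induction i) (auto simp: f0)
      then show ?thesis using nil by (auto simp: K_def funpow_add add.commute[of M])
    qed
    finally show ?thesis .
  qed
  have "K j = UNIV \<or> p ^ j \<le> card (K j)" for j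
  proof (induction j)
    case 0
    then show ?case by (simp add: K_def)
  next
    case (Suc j)
    show ?case
    proof (cases "K j = UNIV")
      case True
      then show ?thesis using sub[of j] by auto
    next
      case False
      then have "K j \<subset> K (Suc j)" using stab sub by blast
      then have less: "card (K j) < card (K (Suc j))" by (intro psubset_card_mono) auto
      obtain a where a: "card (K j) = p ^ a" using dvd[of j] p by (auto simp: divides_primepow_nat)
      obtain b where b: "card (K (Suc j)) = p ^ b" using dvd[of "Suc j"] p by (auto simp: divides_primepow_nat)
      have p1: "1 < p" using p by (rule prime_gt_1_nat)
      have "j \<le> a" using Suc False a p1 by simp
      moreover have "a < b" using less a b p1 by simp
      ultimately show ?thesis unfolding b using p1 power_increasing[of "Suc j" b p] by simp
    qed
  qed
  from this[of n] have "K n = UNIV"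
    using card card_subset_eq[of UNIV "K n"] card_mono[of UNIV "K n"] by fastforce
  then show ?thesis by (auto simp: K_def)
qed

section \<open>The correspondence\<close>

lemma id_mult_pow: "(id_mult m (a, 0) ^^ j) (b, 0) = ((m a ^^ j) b, 0)"
  by (induction j) (simp_all add: id_mult_def)

lemma id_mult_pow_one:
  assumes "m a 0 = 0"
  shows "(id_mult m (a, 0) ^^ Suc j) (0, 1) = ((m a ^^ j) a, 0)"
proof -
  have "id_mult m (a, 0) (0, 1) = (a, 0)" by (simp add: id_mult_def assms)
  then show ?thesis by (simp add: funpow_Suc_right id_mult_pow del: funpow.simps)
qed

locale finite_filtered_algebra = filtered_algebra p n k F m
  for p n k and F :: "nat \<Rightarrow> 'a::{ab_group_add, finite} set" and m +
  assumes card_UNIV: "card (UNIV :: 'a set) = p ^ n" and F_0: "F 0 = UNIV"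
begin

lemma pow_n: "n \<le> j \<Longrightarrow> (m a ^^ j) b = 0"
proof -
  assume "n \<le> j"
  have "(m a ^^ n) x = 0" for x
    by (rule nilpotent_endo_pow[OF prime_p card_UNIV add_right, where M = k])
      (simp add: pow_vanish F_0)
  moreover have "(m a ^^ i) 0 = 0" for i by (induction i) auto
  ultimately show ?thesis
    using \<open>n \<le> j\<close> by (metis (no_types, opaque_lifting) funpow_add le_add_diff_inverse2 o_apply)
qed

lemma pow_k: "k \<le> Suc j \<Longrightarrow> (m a ^^ j) b = 0"
  by (simp add: pow_vanish F_0)

lemma expL_eq_E: "fst (expL p n m a (b, 0)) = E a b"
proof -
  have "(\<Sum>j\<in>{1..n}. zmul (u j) ((m a ^^ j) b)) = (\<Sum>j\<in>{1..<k}. zmul (u j) ((m a ^^ j) b))"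
    by (rule sum.mono_neutral_cong) (auto simp: pow_n pow_k)
  then show ?thesis
    unfolding expL_def E_def k_split by (simp add: id_add_def id_mult_pow)
qed

lemma flowW_eq_W: "flowW p n m a = W a"
proof -
  have "flowW p n m a = (\<Sum>j\<in>{1..n}. zmul (u j) (fst ((id_mult m (a, 0) ^^ j) (0, 1))))"
    by (simp add: flowW_def expL_def id_add_def)
  also have "\<dots> = (\<Sum>j<n. zmul (u (Suc j)) (fst ((id_mult m (a, 0) ^^ Suc j) (0, 1))))"
    by (rule sum.reindex_bij_witness[of _ Suc "\<lambda>j. j - 1"]) auto
  also have "\<dots> = (\<Sum>j<n. zmul (u (Suc j)) ((m a ^^ j) a))"
    by (simp only: id_mult_pow_one[of m a, OF zero_right] fst_conv)
  also have "\<dots> = W a"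
    unfolding W_def by (rule sum.mono_neutral_cong) (auto simp: pow_n pow_k)
  finally show ?thesis .
qed

text \<open>Elements are parametrised as W x from here on, which keeps the inverse
  \<open>flowOmega\<close> out of the later arguments.\<close>

lemma flows_eq: "group_of_flows p n m (W x) b = W x + E x b"
proof -
  have "flowW p n m = W" using flowW_eq_W by blast
  moreover have "inj W" by (rule injI) (simp add: W_inj F_0)
  ultimately have "flowOmega p n m (W x) = x"
    by (simp add: flowOmega_def)
  then show ?thesis by (simp add: group_of_flows_def expL_eq_E)
qed

lemma obtain_W:
  obtains x where "W x = a"
  using W_surj[of a] F_0 by blast

lemma flows_star: "brace_star (group_of_flows p n m) (W x) b = E x b - b"
  by (simp add: brace_star_def flows_eq)

lemma F_flows_star:
  assumes "a \<in> F i" "b \<in> F j"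
  shows "brace_star (group_of_flows p n m) a b \<in> F (i + j)"
proof -
  obtain x where x: "W x = a" by (rule obtain_W)
  then have "x \<in> F i" using W_F_iff[of x i] assms F_0 by simp
  then show ?thesis using E_sub[OF _ assms(2)] x flows_star by metis
qed

lemma strong_series_flows: "strong_series (brace_star (group_of_flows p n m)) i \<subseteq> F i"
  by (rule strong_series_subset) (use F_zero F_diff F_0 F_01 F_flows_star in auto)

end

section \<open>Braces and pre-Lie rings filtered by their strong series\<close>

lemma brace_star_add:
  assumes "is_brace c"
  shows "brace_star c a (b + d) = brace_star c a b + brace_star c a d"
proof -
  have "c a (b + d) + a = c a b + c a d" using assms by (simp add: is_brace_def)
  then show ?thesis by (simp add: brace_star_def algebra_simps)
qed

lemma brace_star_comp:
  assumes "is_brace c"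
  shows "brace_star c (a + b + brace_star c a b) d =
    brace_star c a (brace_star c b d) + brace_star c a d + brace_star c b d"
proof -
  have c: "c x y = x + y + brace_star c x y" for x y by (simp add: brace_star_def)
  have "c (c a b) d = c a (c b d)" using assms by (simp add: is_brace_def is_group_op_def)
  then have "c a b + d + brace_star c (c a b) d = a + c b d + brace_star c a (c b d)"
    by (simp only: c[of "c a b", symmetric] c[of a "c b d", symmetric])
  then show ?thesis
    unfolding c[of a b] c[of b d]
    by (simp add: brace_star_add[OF assms] algebra_simps)
qed

lemma torsion_filtration_strong_series:
  fixes op :: "'a::{ab_group_add, finite} \<Rightarrow> 'a \<Rightarrow> 'a"
  assumes "prime p" "k < p" "2 \<le> k" "card (UNIV :: 'a set) = p ^ n" "strong_series op k \<subseteq> {0}"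
  shows "torsion_filtration p n k (strong_series op)"
proof
  show "zmul (int (p ^ n)) x = 0" for x :: 'a using zmul_card_eq_zero[of x] assms by simp
  show "strong_series op 0 \<subseteq> strong_series op 1" by (simp add: strong_series_le_1)
qed (use assms in \<open>auto intro: strong_series_zero strong_series_diff dest: subsetD[OF strong_series_Suc]\<close>)

lemma filtered_brace_strong_series:
  fixes c :: "'a::{ab_group_add, finite} \<Rightarrow> 'a \<Rightarrow> 'a"
  assumes "prime p" "k < p" "2 \<le> k" "n \<le> p" "card (UNIV :: 'a set) = p ^ n"
    "residue_primroot (p ^ p) \<gamma>" "is_brace c" "strong_series (brace_star c) k \<subseteq> {0}"
  shows "filtered_brace p n k (strong_series (brace_star c)) \<gamma> (brace_star c)"
proof -
  interpret torsion_filtration p n k "strong_series (brace_star c)"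
    using assms by (intro torsion_filtration_strong_series)
  show ?thesis
    by unfold_locales
      (use assms in \<open>auto simp: strong_series_le_1 brace_star_add brace_star_comp intro: strong_series_mult\<close>)
qed

lemma finite_filtered_algebra_strong_series:
  fixes m :: "'a::{ab_group_add, finite} \<Rightarrow> 'a \<Rightarrow> 'a"
  assumes "prime p" "k < p" "2 \<le> k" "card (UNIV :: 'a set) = p ^ n"
    "is_prelie m" "strong_series m k \<subseteq> {0}"
  shows "finite_filtered_algebra p n k (strong_series m) m"
proof -
  interpret torsion_filtration p n k "strong_series m"
    using assms by (intro torsion_filtration_strong_series)
  show ?thesis
    by unfold_locales
      (use assms in \<open>auto simp: strong_series_le_1 is_prelie_def intro: strong_series_mult\<close>)
qed

lemma nilpotency_index_ge_2: "nilpotency_index op k \<Longrightarrow> 2 \<le> k"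
  by (rule ccontr) (auto simp: nilpotency_index_def strong_series_le_1)

lemma (in filtered_brace) assoc_prelie_eq_dot:
  assumes "st = brace_star c"
  shows "assoc_prelie p n \<gamma> c = dot"
proof (intro ext)
  fix a b
  have "{0..p - 2} = {..<p - 1}" using k_ge k_less by auto
  then show "assoc_prelie p n \<gamma> c a b = dot a b"
    by (simp add: assoc_prelie_def assoc_dot_def dot_def coef_def assms[symmetric] Let_def)
qed

lemma (in filtered_brace) strong_series_dot: "strong_series dot i \<subseteq> F i"
  by (rule strong_series_subset) (use F_zero F_diff F_0 F_1 F_dot in auto)

lemma assoc_of_brace:
  fixes c :: "'a::{ab_group_add, finite} \<Rightarrow> 'a \<Rightarrow> 'a"
  assumes p: "prime p" "k < p" "n \<le> p" "card (UNIV :: 'a set) = p ^ n" "residue_primroot (p ^ p) \<gamma>"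
    and c: "c \<in> brace_structures k"
  shows "assoc_prelie p n \<gamma> c \<in> prelie_structures k" "group_of_flows p n (assoc_prelie p n \<gamma> c) = c"
proof -
  let ?S = "strong_series (brace_star c)"
  have b: "is_brace c" and k: "nilpotency_index (brace_star c) k" using c by (auto simp: brace_structures_def)
  have k2: "2 \<le> k" using k by (rule nilpotency_index_ge_2)
  have Sk: "?S k \<subseteq> {0}" using k by (simp add: nilpotency_index_def)
  interpret filtered_brace p n k ?S \<gamma> "brace_star c"
    by (rule filtered_brace_strong_series) (use p b k2 Sk in auto)
  have m: "assoc_prelie p n \<gamma> c = dot" by (rule assoc_prelie_eq_dot) simp
  have pre: "is_prelie dot"
    using dot_add_left dot_add_right dot_prelie by (auto simp: is_prelie_def)
  interpret A: finite_filtered_algebra p n k ?S dot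
    by unfold_locales (use p F_0 in auto)
  show flows: "group_of_flows p n (assoc_prelie p n \<gamma> c) = c"
  proof (intro ext)
    fix a b
    obtain x where "dot.W x = a" "dot.E x b = b + brace_star c a b" using circle_log[of a] by metis
    then show "group_of_flows p n (assoc_prelie p n \<gamma> c) a b = c a b"
      using A.flows_eq[of x b] by (simp add: m brace_star_def algebra_simps)
  qed
  have sub1: "strong_series dot i \<subseteq> ?S i" for i by (rule strong_series_dot)
  \<comment> \<open>For the reverse inclusion: the flows of \<open>dot\<close> give back the brace,
    and their star operation respects the strong series of \<open>dot\<close>.\<close>
  interpret B: finite_filtered_algebra p n k "strong_series dot" dot
    by (rule finite_filtered_algebra_strong_series) (use p k2 pre Sk sub1[of k] in auto)
  have "strong_series dot i = ?S i" for i
    using sub1 B.strong_series_flows[of i] flows by (auto simp: m)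
  then show "assoc_prelie p n \<gamma> c \<in> prelie_structures k"
    using pre k by (simp add: prelie_structures_def m nilpotency_index_def)
qed

lemma is_brace_flows:
  fixes m :: "'a::{ab_group_add, finite} \<Rightarrow> 'a \<Rightarrow> 'a"
  assumes "finite_filtered_algebra p n k F m" "is_prelie m"
  shows "is_brace (group_of_flows p n m)"
proof -
  interpret finite_filtered_algebra p n k F m by fact
  interpret filtered_prelie p n k F m
    by unfold_locales (use assms(2) in \<open>simp add: is_prelie_def\<close>)
  let ?c = "group_of_flows p n m"
  have assoc: "?c (?c a b) d = ?c a (?c b d)" for a b d
  proof -
    obtain x where x: "W x = a" by (rule obtain_W)
    obtain y where y: "W y = b" by (rule obtain_W)
    obtain z where z: "W z = W x + E x (W y)" by (rule obtain_W)
    have "?c (?c a b) d = W z + E z d" using flows_eq[of x b] flows_eq[of z d] x y z by simp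
    also have "\<dots> = W x + E x (W y + E y d)"
      using E_compose[of x y z d] z by (simp add: F_0 E_add)
    also have "\<dots> = ?c a (?c b d)" using flows_eq[of x] flows_eq[of y d] x y by metis
    finally show ?thesis .
  qed
  have c0: "?c 0 a = a" for a using flows_eq[of 0 a] by simp
  have c0': "?c a 0 = a" for a
    using flows_eq[of _ 0] obtain_W[of a] by (metis E_zero_right add.right_neutral)
  have right_inv: "\<exists>b. ?c a b = 0" for a
  proof -
    obtain x where x: "W x = a" by (rule obtain_W)
    \<comment> \<open>On a finite group injectivity gives surjectivity, so E x b = - a is solvable
      and b is a right inverse of a.\<close>
    have "inj (E x)"
      by (rule injI) (metis E_diff E_inj F_0 UNIV_I right_minus_eq)
    then have "surj (E x)" by (simp add: finite_UNIV_inj_surj)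
    then obtain b where "E x b = - a" by (metis surjD)
    then show ?thesis using flows_eq[of x b] x by auto
  qed
  have inv: "\<exists>b. ?c a b = 0 \<and> ?c b a = 0" for a
  proof -
    obtain b where b: "?c a b = 0" using right_inv by blast
    obtain d where d: "?c b d = 0" using right_inv by blast
    have "a = d" using assoc[of a b d] by (simp add: b d c0 c0')
    then show ?thesis using b d by blast
  qed
  have "is_group_op ?c"
    unfolding is_group_op_def using assoc c0 c0' inv by blast
  moreover have "?c a (b + d) + a = ?c a b + ?c a d" for a b d
  proof -
    obtain x where x: "W x = a" by (rule obtain_W)
    show ?thesis unfolding x[symmetric] flows_eq by (simp add: E_add algebra_simps)
  qed
  ultimately show ?thesis by (simp add: is_brace_def)
qed

lemma flows_of_prelie:
  fixes m :: "'a::{ab_group_add, finite} \<Rightarrow> 'a \<Rightarrow> 'a"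
  assumes p: "prime p" "k < p" "n \<le> p" "card (UNIV :: 'a set) = p ^ n" "residue_primroot (p ^ p) \<gamma>"
    and m: "m \<in> prelie_structures k"
  shows "group_of_flows p n m \<in> brace_structures k" "assoc_prelie p n \<gamma> (group_of_flows p n m) = m"
proof -
  let ?c = "group_of_flows p n m"
  have pre: "is_prelie m" and k: "nilpotency_index m k" using m by (auto simp: prelie_structures_def)
  have k2: "2 \<le> k" using k by (rule nilpotency_index_ge_2)
  have Sk: "strong_series m k \<subseteq> {0}" using k by (simp add: nilpotency_index_def)
  interpret finite_filtered_algebra p n k "strong_series m" m
    by (rule finite_filtered_algebra_strong_series) (use p k2 pre Sk in auto)
  have brace: "is_brace ?c" by (rule is_brace_flows[OF _ pre]) unfold_locales
  interpret B: filtered_brace p n k "strong_series m" \<gamma> "brace_star ?c"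
    by unfold_locales
      (use p in \<open>auto simp: F_0 brace_star_add[OF brace] brace_star_comp[OF brace] intro: F_flows_star\<close>)
  show assoc: "assoc_prelie p n \<gamma> ?c = m"
  proof (intro ext)
    fix x b
    \<comment> \<open>The terms of W(t x) are t^(j+1) L_x^j(x) / (j+1)!, so this path has linear
      coefficient x. Hence \<open>B.dot x b\<close> is the linear coefficient of E (t x) b - b,
      which is \<open>m x b\<close>.\<close>
    have "B.expand 0 (\<lambda>t. zmul (int t ^ Suc j) (zmul (u (Suc j)) ((m x ^^ j) x))) 0 (if j = 0 then x else 0)" for j
    proof -
      have "zmul (u (Suc j)) ((m x ^^ j) x) \<in> strong_series m (0 + Suc j)"
        using F_zmul[OF pow_F0[of x x "Suc 0" j]] F_0 B.F_1 by simp
      from B.expand_shift[OF B.expand_const[OF this]] show ?thesis by (cases j) auto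
    qed
    then have "B.expand 0 (\<lambda>t. \<Sum>j<k. zmul (int t ^ Suc j) (zmul (u (Suc j)) ((m x ^^ j) x))) (\<Sum>j<k. 0) (\<Sum>j<k. if j = 0 then x else 0)"
      by (intro B.expand_sum) auto
    then have "B.expand 0 (\<lambda>t. W (zmul (int t) x)) 0 x"
      using k_ge by (simp add: W_def pow_zmul_left pow_zmul_right mult_ac)
    then have "B.dot x b = B.coef 1 (\<lambda>t. brace_star ?c (W (zmul (int t) x)) b)"
      using B.expand_coef[OF B.expand_st_const[of _ x b 0]] F_0 by simp
    also have "\<dots> = B.coef 1 (\<lambda>t. E (zmul (int t) x) b + - b)"
      by (simp add: flows_star)
    also have "\<dots> = B.coef 1 (\<lambda>t. \<Sum>j<k. zmul (int t ^ j) (zmul (u j) ((m x ^^ j) b))) + B.coef 1 (\<lambda>t. - b)"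
      unfolding B.coef_add by (simp add: E_def pow_zmul_left mult.commute)
    also have "\<dots> = m x b"
      using B.coef_poly[of 1 "\<lambda>j. zmul (u j) ((m x ^^ j) b)"] B.expand_coef[OF B.expand_const[of "- b" 0]] k_ge F_0 by simp
    finally show "assoc_prelie p n \<gamma> ?c x b = m x b"
      using B.assoc_prelie_eq_dot[of ?c] by simp
  qed
  have sub: "strong_series (brace_star ?c) i \<subseteq> strong_series m i" for i by (rule strong_series_flows)
  \<comment> \<open>For the reverse inclusion: m is the linear part of the star operation and
    therefore respects the strong series of the star operation itself.\<close>
  interpret C: filtered_brace p n k "strong_series (brace_star ?c)" \<gamma> "brace_star ?c"
    by (rule filtered_brace_strong_series) (use p brace k2 Sk sub[of k] in auto)
  have "strong_series m i \<subseteq> strong_series (brace_star ?c) i" for i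
    using C.strong_series_dot[of i] C.assoc_prelie_eq_dot[of ?c] assoc by simp
  then have "strong_series (brace_star ?c) i = strong_series m i" for i using sub by blast
  then show "?c \<in> brace_structures k"
    using brace k by (simp add: brace_structures_def nilpotency_index_def)
qed

theorem theorem1:
  fixes p n k \<gamma> :: nat
  assumes "prime p" and "k + 1 \<le> p" and "n + 2 \<le> p"
    and "card (UNIV :: 'a::{ab_group_add, finite} set) = p ^ n"
    and "residue_primroot (p ^ p) \<gamma>"
  shows "bij_betw (group_of_flows p n)
           (prelie_structures k :: ('a \<Rightarrow> 'a \<Rightarrow> 'a) set) (brace_structures k)
       \<and> (\<forall>c \<in> (brace_structures k :: ('a \<Rightarrow> 'a \<Rightarrow> 'a) set).
            inv_into (prelie_structures k) (group_of_flows p n) c = assoc_prelie p n \<gamma> c)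
       \<and> card (prelie_structures k :: ('a \<Rightarrow> 'a \<Rightarrow> 'a) set) = card (brace_structures k :: ('a \<Rightarrow> 'a \<Rightarrow> 'a) set)"
proof -
  have p: "prime p" "k < p" "n \<le> p" using assms by auto
  note A = assoc_of_brace[OF p assms(4,5)] and B = flows_of_prelie[OF p assms(4,5)]
  have bij: "bij_betw (group_of_flows p n) (prelie_structures k :: ('a \<Rightarrow> 'a \<Rightarrow> 'a) set) (brace_structures k)"
    by (rule bij_betw_byWitness[where f' = "assoc_prelie p n \<gamma>"]) (use A B in auto)
  moreover have "inv_into (prelie_structures k) (group_of_flows p n) c = assoc_prelie p n \<gamma> c"
    if "c \<in> brace_structures k" for c :: "'a \<Rightarrow> 'a \<Rightarrow> 'a"
    by (rule inv_into_f_eq) (use bij A[OF that] in \<open>auto simp: bij_betw_def\<close>)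
  moreover have "card (prelie_structures k :: ('a \<Rightarrow> 'a \<Rightarrow> 'a) set) = card (brace_structures k :: ('a \<Rightarrow> 'a \<Rightarrow> 'a) set)"
    using bij by (rule bij_betw_same_card)
  ultimately show ?thesis by blast
qed

end
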